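(* Let $(Q,q)$ be a connected quandle with base point $q\in Q$. The functors $\Phi\colon\mathbf{Cov}(Q)\to\mathbf{Act}(\pi_1(Q,q))$ and $\Psi\colon\mathbf{Act}(\pi_1(Q,q))\to\mathbf{Cov}(Q)$ described in the context establish a natural equivalence between the category of coverings of $Q$ and the category of sets endowed with an action of $\pi_1(Q,q)$.
   Context: A quandle is a set $Q$ with two binary operations $*,\bar{*}$ such that for all $a,b,c\in Q$: $a*a=a$; $(a*b)\bar{*}b=a=(a\bar{*}b)*b$; $(a*b)*c=(a*c)*(b*c)$. A quandle homomorphism is a map preserving $*$ (hence $\bar{*}$). $\mathrm{Inn}(Q)$ is the group of automorphisms of $Q$ generated by the right translations $x\mapsto x*a$ ($a\in Q$); $Q$ is connected if $\mathrm{Inn}(Q)$ acts transitively on $Q$. A quandle homomorphism $p\colon\tilde Q\to Q$ is a covering if it is surjective and $p(\tilde y)=p(\tilde z)$ implies $\tilde x*\tilde y=\tilde x*\tilde z$ for all $\tilde x,\tilde y,\tilde z\in\tilde Q$. The category $\mathbf{Cov}(Q)$ has the (not necessarily connected) coverings of $Q$ as objects; a morphism from $p\colon\tilde Q\to Q$ to $\hat p\colon\hat Q\to Q$ is a quandle homomorphism $\phi\colon\tilde Q\to\hat Q$ with $\hat p\circ\phi=p$. For a group $G$, the category $\mathbf{Act}(G)$ has as objects the $G$-sets, i.e. pairs $(X,\alpha)$ of a set $X$ and a right action $\alpha\colon X\times G\to X$, $(x,g)\mapsto x^g$; morphisms are equivariant maps. The adjoint group $\mathrm{Adj}(Q)$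 is generated by symbols $\mathrm{adj}(a)$, $a\in Q$, subject to $\mathrm{adj}(a*b)=\mathrm{adj}(b)^{-1}\mathrm{adj}(a)\,\mathrm{adj}(b)$. It acts on $Q$ from the right by quandle automorphisms with $a^{\mathrm{adj}(b)}=a*b$. Let $\varepsilon\colon\mathrm{Adj}(Q)\to\mathbb{Z}$ be the homomorphism with $\varepsilon(\mathrm{adj}(a))=1$ for all $a\in Q$, and $\mathrm{Adj}(Q)^\circ=\ker\varepsilon$ (the commutator subgroup, since $Q$ is connected). The fundamental group is $\pi_1(Q,q)=\{g\in\mathrm{Adj}(Q)^\circ\mid q^g=q\}$. The functor $\Phi$: for a covering $p\colon\tilde Q\to Q$ the group $\mathrm{Adj}(Q)$ acts on $\tilde Q$ from the right by $\tilde x^{\mathrm{adj}(b)}=\tilde x*\tilde b$ for any $\tilde b\in p^{-1}(b)$, and $p$ is equivariant; the monodromy action is the induced action $\alpha$ of $\pi_1(Q,q)$ on the fibre $F=p^{-1}(q)$. $\Phi$ sends $p$ to $(F,\alpha)$ and a covering morphism to its restriction to the fibres over $q$. The functor $\Psi$: let $p\colon(\tilde Q,\tilde q)\to(Q,q)$ be the universal connected covering, explicitly $\tilde Q=\{(a,g)\in Q\times\mathrm{Adj}(Q)^\circ\mid a=q^g\}$ with $(a,g)*(b,h)=(a*b,\,g\,\mathrm{adj}(a)^{-1}\mathrm{adj}(b))$, $\tilde q=(q,1)$ and $p(a,g)=a$; the group $\pi_1(Q,q)$ acts on $\tilde Q$ from the left by deck transformations $h\cdot(a,g)=(a,hg)$.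 $\Psi$ sends an action $\alpha\colon F\times\pi_1(Q,q)\to F$ to the covering $p_\alpha\colon\tilde Q_\alpha\to Q$, where $\tilde Q_\alpha=(F\times\tilde Q)/\pi_1(Q,q)$ is the quotient of $F\times\tilde Q$ by $(x^g,\tilde a)\sim(x,g\cdot\tilde a)$, with operation $[x,\tilde a]*[y,\tilde b]=[x,\tilde a*\tilde b]$ and $p_\alpha([x,\tilde a])=p(\tilde a)$; a morphism $\phi$ of $\pi_1(Q,q)$-sets is sent to the map induced by $\phi\times\mathrm{id}$.
   Formalization: The empty set with its action of π₁(Q,q) is excluded from Act(π₁(Q,q)), because Ψ would send it to the empty quandle, which is not a covering as it does not surject onto Q. *)

theory Defs
  imports "HOL-Algebra.Bij" "HOL-Algebra.Free_Abelian_Groups"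
begin

section \<open>Categories, functors, equivalences\<close>

text \<open>
  Categories are given by hom-sets. Composition and the arrow part of a functor take the
  objects as arguments, because arrows will be extensional functions, which do not know their
  domain and codomain.
\<close>

record ('o, 'm) category_data =
  Obj :: "'o set"
  Hom :: "'o \<Rightarrow> 'o \<Rightarrow> 'm set"
  Ident :: "'o \<Rightarrow> 'm"
  Comp :: "'o \<Rightarrow> 'o \<Rightarrow> 'o \<Rightarrow> 'm \<Rightarrow> 'm \<Rightarrow> 'm"

definition is_category :: "('o, 'm) category_data \<Rightarrow> bool" where
  "is_category C \<longleftrightarrow>
     (\<forall>X\<in>Obj C. Ident C X \<in> Hom C X X) \<and>
     (\<forall>X\<in>Obj C. \<forall>Y\<in>Obj C. \<forall>Z\<in>Obj C. \<forall>f\<in>Hom C X Y. \<forall>g\<in>Hom C Y Z.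
        Comp C X Y Z g f \<in> Hom C X Z) \<and>
     (\<forall>X\<in>Obj C. \<forall>Y\<in>Obj C. \<forall>f\<in>Hom C X Y.
        Comp C X X Y f (Ident C X) = f \<and> Comp C X Y Y (Ident C Y) f = f) \<and>
     (\<forall>W\<in>Obj C. \<forall>X\<in>Obj C. \<forall>Y\<in>Obj C. \<forall>Z\<in>Obj C.
        \<forall>f\<in>Hom C W X. \<forall>g\<in>Hom C X Y. \<forall>h\<in>Hom C Y Z.
        Comp C W Y Z h (Comp C W X Y g f) = Comp C W X Z (Comp C X Y Z h g) f)"

record ('o, 'm, 'p, 'n) functor_data =
  fobj :: "'o \<Rightarrow> 'p"
  fmap :: "'o \<Rightarrow> 'o \<Rightarrow> 'm \<Rightarrow> 'n"

definition is_functor ::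
  "('o, 'm) category_data \<Rightarrow> ('p, 'n) category_data \<Rightarrow> ('o, 'm, 'p, 'n) functor_data \<Rightarrow> bool"
where
  "is_functor C D F \<longleftrightarrow>
     (\<forall>X\<in>Obj C. fobj F X \<in> Obj D) \<and>
     (\<forall>X\<in>Obj C. \<forall>Y\<in>Obj C. \<forall>f\<in>Hom C X Y.
        fmap F X Y f \<in> Hom D (fobj F X) (fobj F Y)) \<and>
     (\<forall>X\<in>Obj C. fmap F X X (Ident C X) = Ident D (fobj F X)) \<and>
     (\<forall>X\<in>Obj C. \<forall>Y\<in>Obj C. \<forall>Z\<in>Obj C. \<forall>f\<in>Hom C X Y. \<forall>g\<in>Hom C Y Z.
        fmap F X Z (Comp C X Y Z g f) =
        Comp D (fobj F X) (fobj F Y) (fobj F Z) (fmap F Y Z g) (fmap F X Y f))"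

definition id_functor :: "('o, 'm, 'o, 'm) functor_data" where
  "id_functor = \<lparr>fobj = (\<lambda>X. X), fmap = (\<lambda>X Y f. f)\<rparr>"

definition comp_functor ::
  "('p, 'n, 'r, 'l) functor_data \<Rightarrow> ('o, 'm, 'p, 'n) functor_data \<Rightarrow> ('o, 'm, 'r, 'l) functor_data"
where
  "comp_functor G F =
     \<lparr>fobj = (\<lambda>X. fobj G (fobj F X)),
      fmap = (\<lambda>X Y f. fmap G (fobj F X) (fobj F Y) (fmap F X Y f))\<rparr>"

definition is_iso :: "('o, 'm) category_data \<Rightarrow> 'o \<Rightarrow> 'o \<Rightarrow> 'm \<Rightarrow> bool" where
  "is_iso C X Y f \<longleftrightarrow> f \<in> Hom C X Y \<and>
     (\<exists>g\<in>Hom C Y X. Comp C X Y X g f = Ident C X \<and> Comp C Y X Y f g = Ident C Y)"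

definition natural_iso ::
  "('o, 'm) category_data \<Rightarrow> ('p, 'n) category_data \<Rightarrow>
   ('o, 'm, 'p, 'n) functor_data \<Rightarrow> ('o, 'm, 'p, 'n) functor_data \<Rightarrow> ('o \<Rightarrow> 'n) \<Rightarrow> bool"
where
  "natural_iso C D F G \<eta> \<longleftrightarrow>
     (\<forall>X\<in>Obj C. is_iso D (fobj F X) (fobj G X) (\<eta> X)) \<and>
     (\<forall>X\<in>Obj C. \<forall>Y\<in>Obj C. \<forall>f\<in>Hom C X Y.
        Comp D (fobj F X) (fobj F Y) (fobj G Y) (\<eta> Y) (fmap F X Y f) =
        Comp D (fobj F X) (fobj G X) (fobj G Y) (fmap G X Y f) (\<eta> X))"

definition equivalence_of_categories ::
  "('o, 'm) category_data \<Rightarrow> ('p, 'n) category_data \<Rightarrow>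
   ('o, 'm, 'p, 'n) functor_data \<Rightarrow> ('p, 'n, 'o, 'm) functor_data \<Rightarrow> bool"
where
  "equivalence_of_categories C D F G \<longleftrightarrow>
     is_category C \<and> is_category D \<and> is_functor C D F \<and> is_functor D C G \<and>
     (\<exists>\<eta>. natural_iso C C id_functor (comp_functor G F) \<eta>) \<and>
     (\<exists>\<theta>. natural_iso D D id_functor (comp_functor F G) \<theta>)"


section \<open>Quandles and coverings\<close>

record 'a quandle = "'a partial_object" +
  qop :: "'a \<Rightarrow> 'a \<Rightarrow> 'a" (infixl \<open>\<triangleright>\<index>\<close> 70)
  qbar :: "'a \<Rightarrow> 'a \<Rightarrow> 'a" (infixl \<open>\<triangleleft>\<index>\<close> 70)

locale quandle =
  fixes Q :: "('a, 'm) quandle_scheme" (structure)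
  assumes op_closed: "a \<in> carrier Q \<Longrightarrow> b \<in> carrier Q \<Longrightarrow> a \<triangleright> b \<in> carrier Q"
    and bar_closed: "a \<in> carrier Q \<Longrightarrow> b \<in> carrier Q \<Longrightarrow> a \<triangleleft> b \<in> carrier Q"
    and idem: "a \<in> carrier Q \<Longrightarrow> a \<triangleright> a = a"
    and op_bar: "a \<in> carrier Q \<Longrightarrow> b \<in> carrier Q \<Longrightarrow> (a \<triangleright> b) \<triangleleft> b = a"
    and bar_op: "a \<in> carrier Q \<Longrightarrow> b \<in> carrier Q \<Longrightarrow> (a \<triangleleft> b) \<triangleright> b = a"
    and distrib: "a \<in> carrier Q \<Longrightarrow> b \<in> carrier Q \<Longrightarrow> c \<in> carrier Q \<Longrightarrow>
                  (a \<triangleright> b) \<triangleright> c = (a \<triangleright> c) \<triangleright> (b \<triangleright> c)"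

definition quandle_hom ::
  "('b, 'm) quandle_scheme \<Rightarrow> ('c, 'n) quandle_scheme \<Rightarrow> ('b \<Rightarrow> 'c) set"
where
  "quandle_hom P R = {f \<in> carrier P \<rightarrow> carrier R.
     \<forall>x\<in>carrier P. \<forall>y\<in>carrier P. f (x \<triangleright>\<^bsub>P\<^esub> y) = f x \<triangleright>\<^bsub>R\<^esub> f y}"

definition Inn :: "('a, 'm) quandle_scheme \<Rightarrow> ('a \<Rightarrow> 'a) set" where
  "Inn Q = generate (BijGroup (carrier Q))
     ((\<lambda>a. \<lambda>x\<in>carrier Q. x \<triangleright>\<^bsub>Q\<^esub> a) ` carrier Q)"

locale connected_quandle = quandle +
  assumes Inn_transitive:
    "x \<in> carrier Q \<Longrightarrow> y \<in> carrier Q \<Longrightarrow> \<exists>f\<in>Inn Q. f x = y"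

record ('b, 'a) covering = "'b quandle" +
  proj :: "'b \<Rightarrow> 'a"

definition is_covering :: "('a, 'm) quandle_scheme \<Rightarrow> ('b, 'a, 'n) covering_scheme \<Rightarrow> bool" where
  "is_covering Q P \<longleftrightarrow> quandle P \<and> quandle Q \<and> proj P \<in> quandle_hom P Q \<and>
     proj P ` carrier P = carrier Q \<and>
     (\<forall>x\<in>carrier P. \<forall>y\<in>carrier P. \<forall>z\<in>carrier P.
        proj P y = proj P z \<longrightarrow> x \<triangleright>\<^bsub>P\<^esub> y = x \<triangleright>\<^bsub>P\<^esub> z)"

definition cov_hom ::
  "('b, 'a, 'm) covering_scheme \<Rightarrow> ('c, 'a, 'n) covering_scheme \<Rightarrow> ('b \<Rightarrow> 'c) set"
where
  "cov_hom P R = {\<phi> \<in> quandle_hom P R \<inter> extensional (carrier P).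
     \<forall>x\<in>carrier P. proj R (\<phi> x) = proj P x}"

definition Cov :: "('a, 'm) quandle_scheme \<Rightarrow> (('b, 'a) covering, 'b \<Rightarrow> 'b) category_data" where
  "Cov Q = \<lparr>Obj = {P. is_covering Q P}, Hom = cov_hom,
     Ident = (\<lambda>P. \<lambda>x\<in>carrier P. x),
     Comp = (\<lambda>P R S g f. compose (carrier P) g f)\<rparr>"


section \<open>Sets with a right group action\<close>

record ('x, 'g) gset = "'x partial_object" +
  act :: "'x \<Rightarrow> 'g \<Rightarrow> 'x"

definition right_action :: "('g, 'm) monoid_scheme \<Rightarrow> ('x, 'g) gset \<Rightarrow> bool" where
  "right_action G X \<longleftrightarrow>
     (\<forall>x\<in>carrier X. \<forall>g\<in>carrier G. act X x g \<in> carrier X) \<and>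
     (\<forall>x\<in>carrier X. act X x \<one>\<^bsub>G\<^esub> = x) \<and>
     (\<forall>x\<in>carrier X. \<forall>g\<in>carrier G. \<forall>h\<in>carrier G.
        act X x (g \<otimes>\<^bsub>G\<^esub> h) = act X (act X x g) h)"

definition act_hom ::
  "('g, 'm) monoid_scheme \<Rightarrow> ('x, 'g) gset \<Rightarrow> ('y, 'g) gset \<Rightarrow> ('x \<Rightarrow> 'y) set"
where
  "act_hom G X Y = {\<phi> \<in> carrier X \<rightarrow>\<^sub>E carrier Y.
     \<forall>x\<in>carrier X. \<forall>g\<in>carrier G. \<phi> (act X x g) = act Y (\<phi> x) g}"

text \<open>
  The empty \<open>G\<close>-set is excluded: coverings are surjective onto a nonempty quandle, so their fibres
  are nonempty, and the covering associated with the empty set would not be surjective.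
\<close>

definition Act :: "('g, 'm) monoid_scheme \<Rightarrow> (('x, 'g) gset, 'x \<Rightarrow> 'x) category_data" where
  "Act G = \<lparr>Obj = {X. right_action G X \<and> carrier X \<noteq> {}}, Hom = act_hom G,
     Ident = (\<lambda>X. \<lambda>x\<in>carrier X. x),
     Comp = (\<lambda>X Y Z g f. compose (carrier X) g f)\<rparr>"


section \<open>The adjoint group and the fundamental group\<close>

text \<open>
  A word is a list of letters; \<open>(a, True)\<close> stands for \<open>adj a\<close> and \<open>(a, False)\<close> for its
  inverse. The adjoint group consists of the words modulo the congruence generated by free
  cancellation and the defining relations.
\<close>

type_synonym 'a adj_word = "('a \<times> bool) list"
type_synonym 'a adj = "'a adj_word set"

definition adj_words :: "('a, 'm) quandle_scheme \<Rightarrow> 'a adj_word set" where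
  "adj_words Q = lists (carrier Q \<times> UNIV)"

inductive_set adj_rel :: "('a, 'm) quandle_scheme \<Rightarrow> ('a adj_word \<times> 'a adj_word) set"
  for Q :: "('a, 'm) quandle_scheme"
where
  refl: "w \<in> adj_words Q \<Longrightarrow> (w, w) \<in> adj_rel Q"
| sym: "(u, v) \<in> adj_rel Q \<Longrightarrow> (v, u) \<in> adj_rel Q"
| trans: "(u, v) \<in> adj_rel Q \<Longrightarrow> (v, w) \<in> adj_rel Q \<Longrightarrow> (u, w) \<in> adj_rel Q"
| cong: "(u, v) \<in> adj_rel Q \<Longrightarrow> s \<in> adj_words Q \<Longrightarrow> t \<in> adj_words Q \<Longrightarrow>
         (s @ u @ t, s @ v @ t) \<in> adj_rel Q"
| cancel: "a \<in> carrier Q \<Longrightarrow> ([(a, e), (a, \<not> e)], []) \<in> adj_rel Q"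
| conj: "a \<in> carrier Q \<Longrightarrow> b \<in> carrier Q \<Longrightarrow>
         ([(a \<triangleright>\<^bsub>Q\<^esub> b, True)], [(b, False), (a, True), (b, True)]) \<in> adj_rel Q"

definition Adj :: "('a, 'm) quandle_scheme \<Rightarrow> 'a adj monoid" where
  "Adj Q = \<lparr>carrier = adj_words Q // adj_rel Q,
     mult = (\<lambda>g h. \<Union>u\<in>g. \<Union>v\<in>h. adj_rel Q `` {u @ v}),
     one = adj_rel Q `` {[]}\<rparr>"

definition adj :: "('a, 'm) quandle_scheme \<Rightarrow> 'a \<Rightarrow> 'a adj" where
  "adj Q a = adj_rel Q `` {[(a, True)]}"

text \<open>
  The next two functions are evaluated on an arbitrary word representing \<open>g\<close>; the result
  does not depend on the choice.
\<close>

definition adj_eps :: "'a adj \<Rightarrow> int" where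
  "adj_eps g = (\<Sum>(a, e)\<leftarrow>(SOME w. w \<in> g). if e then 1 else - 1)"

text \<open>
  Right action of \<open>Adj Q\<close> on \<open>R\<close>, where \<open>s\<close> chooses for \<open>b \<in> Q\<close> the element of \<open>R\<close>
  by which \<open>adj b\<close> translates.
\<close>

definition letter_act :: "('b, 'm) quandle_scheme \<Rightarrow> ('a \<Rightarrow> 'b) \<Rightarrow> 'b \<Rightarrow> 'a \<times> bool \<Rightarrow> 'b" where
  "letter_act R s x l =
     (if snd l then x \<triangleright>\<^bsub>R\<^esub> s (fst l) else x \<triangleleft>\<^bsub>R\<^esub> s (fst l))"

definition adj_act :: "('b, 'm) quandle_scheme \<Rightarrow> ('a \<Rightarrow> 'b) \<Rightarrow> 'b \<Rightarrow> 'a adj \<Rightarrow> 'b" where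
  "adj_act R s x g = foldl (letter_act R s) x (SOME w. w \<in> g)"

definition quandle_act :: "('a, 'm) quandle_scheme \<Rightarrow> 'a \<Rightarrow> 'a adj \<Rightarrow> 'a" where
  "quandle_act Q = adj_act Q (\<lambda>b. b)"

definition cov_act :: "('b, 'a, 'm) covering_scheme \<Rightarrow> 'b \<Rightarrow> 'a adj \<Rightarrow> 'b" where
  "cov_act P = adj_act P (\<lambda>b. SOME y. y \<in> carrier P \<and> proj P y = b)"

definition Adj0 :: "('a, 'm) quandle_scheme \<Rightarrow> 'a adj set" where
  "Adj0 Q = kernel (Adj Q) integer_group adj_eps"

definition pi1 :: "('a, 'm) quandle_scheme \<Rightarrow> 'a \<Rightarrow> 'a adj monoid" where
  "pi1 Q q = (Adj Q)\<lparr>carrier := {g \<in> Adj0 Q. quandle_act Q q g = q}\<rparr>"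


section \<open>The functors\<close>

definition Phi :: "('a, 'm) quandle_scheme \<Rightarrow> 'a \<Rightarrow>
  (('b, 'a) covering, 'b \<Rightarrow> 'b, ('b, 'a adj) gset, 'b \<Rightarrow> 'b) functor_data"
where
  "Phi Q q =
     \<lparr>fobj = (\<lambda>P. \<lparr>carrier = {x \<in> carrier P. proj P x = q}, act = cov_act P\<rparr>),
      fmap = (\<lambda>P R \<phi>. \<lambda>x\<in>{x \<in> carrier P. proj P x = q}. \<phi> x)\<rparr>"

text \<open>The second operation is forced by the quandle axioms.\<close>

definition univ_cov :: "('a, 'm) quandle_scheme \<Rightarrow> 'a \<Rightarrow> ('a \<times> 'a adj, 'a) covering" where
  "univ_cov Q q =
     \<lparr>carrier = {(a, g). a \<in> carrier Q \<and> g \<in> Adj0 Q \<and> a = quandle_act Q q g},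
      qop = (\<lambda>(a, g) (b, h).
        (a \<triangleright>\<^bsub>Q\<^esub> b, g \<otimes>\<^bsub>Adj Q\<^esub> inv\<^bsub>Adj Q\<^esub> adj Q a \<otimes>\<^bsub>Adj Q\<^esub> adj Q b)),
      qbar = (\<lambda>(a, g) (b, h).
        (a \<triangleleft>\<^bsub>Q\<^esub> b, g \<otimes>\<^bsub>Adj Q\<^esub> adj Q a \<otimes>\<^bsub>Adj Q\<^esub> inv\<^bsub>Adj Q\<^esub> adj Q b)),
      proj = fst\<rparr>"

definition deck :: "('a, 'm) quandle_scheme \<Rightarrow> 'a adj \<Rightarrow> 'a \<times> 'a adj \<Rightarrow> 'a \<times> 'a adj" where
  "deck Q h z = (fst z, h \<otimes>\<^bsub>Adj Q\<^esub> snd z)"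

definition psi_rel :: "('a, 'm) quandle_scheme \<Rightarrow> 'a \<Rightarrow> ('x, 'a adj) gset \<Rightarrow>
  (('x \<times> 'a \<times> 'a adj) \<times> ('x \<times> 'a \<times> 'a adj)) set"
where
  "psi_rel Q q X = {((act X x g, z), (x, deck Q g z)) | x g z.
     x \<in> carrier X \<and> g \<in> carrier (pi1 Q q) \<and> z \<in> carrier (univ_cov Q q)}"

definition psi_cov :: "('a, 'm) quandle_scheme \<Rightarrow> 'a \<Rightarrow> ('x, 'a adj) gset \<Rightarrow>
  (('x \<times> 'a \<times> 'a adj) set, 'a) covering"
where
  "psi_cov Q q X =
     \<lparr>carrier = (carrier X \<times> carrier (univ_cov Q q)) // psi_rel Q q X,
      qop = (\<lambda>A B. \<Union>(x, z)\<in>A. \<Union>(y, w)\<in>B.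
        psi_rel Q q X `` {(x, z \<triangleright>\<^bsub>univ_cov Q q\<^esub> w)}),
      qbar = (\<lambda>A B. \<Union>(x, z)\<in>A. \<Union>(y, w)\<in>B.
        psi_rel Q q X `` {(x, z \<triangleleft>\<^bsub>univ_cov Q q\<^esub> w)}),
      proj = (\<lambda>A. the_elem ((\<lambda>(x, z). proj (univ_cov Q q) z) ` A))\<rparr>"

definition Psi :: "('a, 'm) quandle_scheme \<Rightarrow> 'a \<Rightarrow>
  (('x, 'a adj) gset, 'x \<Rightarrow> 'x, (('x \<times> 'a \<times> 'a adj) set, 'a) covering,
   ('x \<times> 'a \<times> 'a adj) set \<Rightarrow> ('x \<times> 'a \<times> 'a adj) set) functor_data"
where
  "Psi Q q =
     \<lparr>fobj = psi_cov Q q,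
      fmap = (\<lambda>X Y \<phi>. \<lambda>A\<in>carrier (psi_cov Q q X).
        \<Union>(x, z)\<in>A. psi_rel Q q Y `` {(\<phi> x, z)})\<rparr>"


section \<open>Change of universe\<close>

text \<open>
  The type parameter \<open>'b\<close> of \<^term>\<open>Cov Q\<close> plays the role of a universe: it provides the elements
  of the covering quandles. The quotient set underlying \<^term>\<open>psi_cov Q q X\<close> is a set of
  equivalence classes and therefore lives in a different type than \<^term>\<open>carrier X\<close>.
  Hence isomorphisms are also needed between objects over different types, and, in order to
  get two functors between the same two categories, coverings have to be transported along
  an injection of their carrier into another type.
\<close>

definition cov_iso ::
  "('b, 'a, 'm) covering_scheme \<Rightarrow> ('c, 'a, 'n) covering_scheme \<Rightarrow> ('b \<Rightarrow> 'c) \<Rightarrow> bool"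
where
  "cov_iso P R \<phi> \<longleftrightarrow> \<phi> \<in> cov_hom P R \<and>
     (\<exists>\<psi>\<in>cov_hom R P. (\<forall>x\<in>carrier P. \<psi> (\<phi> x) = x) \<and> (\<forall>y\<in>carrier R. \<phi> (\<psi> y) = y))"

definition act_iso ::
  "('g, 'm) monoid_scheme \<Rightarrow> ('x, 'g) gset \<Rightarrow> ('y, 'g) gset \<Rightarrow> ('x \<Rightarrow> 'y) \<Rightarrow> bool"
where
  "act_iso G X Y \<phi> \<longleftrightarrow> \<phi> \<in> act_hom G X Y \<and>
     (\<exists>\<psi>\<in>act_hom G Y X. (\<forall>x\<in>carrier X. \<psi> (\<phi> x) = x) \<and> (\<forall>y\<in>carrier Y. \<phi> (\<psi> y) = y))"

definition relabel ::
  "('b \<Rightarrow> 'c) \<Rightarrow> (('b, 'a) covering, 'b \<Rightarrow> 'b, ('c, 'a) covering, 'c \<Rightarrow> 'c) functor_data"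
where
  "relabel j =
     \<lparr>fobj = (\<lambda>P. let i = inv_into (carrier P) j in
        \<lparr>carrier = j ` carrier P,
         qop = (\<lambda>x y. j (i x \<triangleright>\<^bsub>P\<^esub> i y)),
         qbar = (\<lambda>x y. j (i x \<triangleleft>\<^bsub>P\<^esub> i y)),
         proj = (\<lambda>x. proj P (i x))\<rparr>),
      fmap = (\<lambda>P R \<phi>. \<lambda>x\<in>j ` carrier P. j (\<phi> (inv_into (carrier P) j x)))\<rparr>"

text \<open>
  Let \<open>'u\<close> be a universe with an injection \<open>\<iota>\<close> from the product of \<open>'u\<close> with the universal
  covering into \<open>'u\<close>. Then classes are represented in \<open>'u\<close> by coding a representative.
\<close>

definition class_code :: "('u \<times> 'a \<times> 'a adj \<Rightarrow> 'u) \<Rightarrow> ('u \<times> 'a \<times> 'a adj) set \<Rightarrow> 'u" where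
  "class_code \<iota> A = \<iota> (SOME t. t \<in> A)"

definition Psi_in :: "('u \<times> 'a \<times> 'a adj \<Rightarrow> 'u) \<Rightarrow> ('a, 'm) quandle_scheme \<Rightarrow> 'a \<Rightarrow>
  (('u, 'a adj) gset, 'u \<Rightarrow> 'u, ('u, 'a) covering, 'u \<Rightarrow> 'u) functor_data"
where
  "Psi_in \<iota> Q q = comp_functor (relabel (class_code \<iota>)) (Psi Q q)"

text \<open>Every infinite type into which \<open>Q\<close> embeds is such a universe.\<close>

lemma universe_exists:
  fixes Q :: "('a, 'm) quandle_scheme" and e :: "'a \<Rightarrow> 'u"
  assumes inf: "infinite (UNIV :: 'u set)" and e: "inj_on e (carrier Q)"
  shows "\<exists>\<iota> :: 'u \<times> 'a \<times> 'a adj \<Rightarrow> 'u. inj_on \<iota> (UNIV \<times> carrier (univ_cov Q q))"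
proof -
  let ?U = "UNIV :: 'u set"
  have QU: "|carrier Q| \<le>o |?U|"
    using e card_of_ordLeq[of "carrier Q" ?U] by auto
  have BU: "|UNIV :: bool set| \<le>o |?U|"
    using inf by (simp add: ordLess_imp_ordLeq finite_ordLess_infinite2)
  have "|carrier Q \<times> (UNIV :: bool set)| \<le>o |?U|"
    using card_of_Sigma_ordLeq_infinite[OF inf QU, of "\<lambda>_. UNIV"] BU by blast
  then have "|adj_words Q| \<le>o |lists ?U|"
    unfolding adj_words_def by (rule card_of_lists_mono)
  then have WU: "|adj_words Q| \<le>o |?U|"
    using card_of_lists_infinite[OF inf] ordLeq_ordIso_trans by blast
  have "carrier (Adj Q) = (\<lambda>w. adj_rel Q `` {w}) ` adj_words Q"
    by (auto simp: Adj_def quotient_def)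
  then have "|carrier (Adj Q)| \<le>o |adj_words Q|"
    by (metis card_of_image)
  then have AU: "|carrier (Adj Q)| \<le>o |?U|"
    using WU ordLeq_transitive by blast
  have "carrier (univ_cov Q q) \<subseteq> carrier Q \<times> carrier (Adj Q)"
    by (auto simp: univ_cov_def Adj0_def kernel_def)
  then have "|carrier (univ_cov Q q)| \<le>o |carrier Q \<times> carrier (Adj Q)|"
    by (rule card_of_mono1)
  also have "|carrier Q \<times> carrier (Adj Q)| \<le>o |?U|"
    using card_of_Sigma_ordLeq_infinite[OF inf QU, of "\<lambda>_. carrier (Adj Q)"] AU by blast
  finally (ordLeq_transitive) have CU: "|carrier (univ_cov Q q)| \<le>o |?U|" .
  have "|?U \<times> carrier (univ_cov Q q)| \<le>o |?U|"
    using card_of_Sigma_ordLeq_infinite[OF inf, of ?U "\<lambda>_. carrier (univ_cov Q q)"] CU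
    by (simp add: ordLeq_refl)
  then show ?thesis
    using card_of_ordLeq[of "?U \<times> carrier (univ_cov Q q)" ?U] by blast
qed

end

theory Submission
  imports Defs
begin

text \<open>
  A covering \<open>p\<close> of \<open>Q\<close> carries a right action of \<open>Adj Q\<close> that lifts the action on \<open>Q\<close>: the
  generator \<open>adj b\<close> acts by translation with any element over \<open>b\<close>, and the covering axiom says that
  the choice does not matter (\<open>covering_adj_action\<close>, \<open>cov_act_adj\<close>). Morphisms of coverings
  commute with it (\<open>cov_hom_equivariant\<close>). Conversely, the action determines the operation of the
  covering quandle, since \<open>x * y = x\<^bsup>adj (p y)\<^esup>\<close>. The degree zero part of \<open>Adj Q\<close> is transitive
  on \<open>Q\<close> (\<open>Adj0_transitive\<close>), so a covering is known once its fibre over \<open>q\<close> is known together with the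
  action of the stabiliser of \<open>q\<close>, which is the fundamental group. This is the same mechanism by
  which covering spaces correspond to sets with an action of the fundamental group.

  The degree zero part suffices, and is the right group, because every element over \<open>q\<close>
  is idempotent and is therefore fixed by \<open>adj q\<close>.

  Concretely, in \<open>\<Psi> (\<Phi> P)\<close> the class \<open>[x, (a, g)]\<close> consists of a point \<open>x\<close> over \<open>q\<close> and a ``path''
  \<open>g\<close> from \<open>q\<close> to \<open>a\<close>. Transport along the path, \<open>[x, (a, g)] \<mapsto> x\<^sup>g\<close>, is a well-defined
  isomorphism of coverings onto \<open>P\<close> (\<open>fibre_transport_hom\<close>, \<open>fibre_transport_bij\<close>) and its
  inverse is the natural isomorphism \<open>Id \<rightarrow> \<Psi> \<Phi>\<close> (\<open>cov_unit_natural\<close>). In the other direction, \<open>x \<mapsto> [x, (q, 1)]\<close>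
  identifies \<open>X\<close> with the fibre of \<open>\<Psi> X\<close>; it is equivariant because the degree zero
  elements act on the base point \<open>(q, 1)\<close> of the universal covering by right multiplication
  (\<open>univ_cov_act\<close>, \<open>psi_cov_act\<close>).

  Replacing classes by codes in a fixed universe only transports the coverings
  along a bijection of their carriers, so the same two natural isomorphisms, followed by the coding,
  give the equivalence in the second half of the theorem.
\<close>

section \<open>The adjoint group\<close>

context quandle
begin

abbreviation word_class :: "'a adj_word \<Rightarrow> 'a adj" where
  "word_class w \<equiv> adj_rel Q `` {w}"

abbreviation adj_mult (infixl \<open>\<cdot>\<close> 70) where
  "g \<cdot> h \<equiv> g \<otimes>\<^bsub>Adj Q\<^esub> h"

abbreviation adj_inv (\<open>(_\<^sup>\<inverse>)\<close> [1000] 999) where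
  "g\<^sup>\<inverse> \<equiv> inv\<^bsub>Adj Q\<^esub> g"

abbreviation adj_gen where
  "adj_gen \<equiv> adj Q"

lemma adj_rel_words: "(u, v) \<in> adj_rel Q \<Longrightarrow> u \<in> adj_words Q \<and> v \<in> adj_words Q"
  by (induction rule: adj_rel.induct) (auto simp: adj_words_def op_closed)

lemma adj_words_simps [simp]:
  "[] \<in> adj_words Q"
  "l # w \<in> adj_words Q \<longleftrightarrow> fst l \<in> carrier Q \<and> w \<in> adj_words Q"
  "v @ w \<in> adj_words Q \<longleftrightarrow> v \<in> adj_words Q \<and> w \<in> adj_words Q"
  by (auto simp: adj_words_def mem_Times_iff)

lemma equiv_adj_rel: "equiv (adj_words Q) (adj_rel Q)"
proof (rule equivI)
  show "adj_rel Q \<subseteq> adj_words Q \<times> adj_words Q"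
    using adj_rel_words by auto
  show "refl_on (adj_words Q) (adj_rel Q)"
    by (simp add: refl_on_def adj_rel.refl)
  show "sym (adj_rel Q)"
    by (rule symI) (rule adj_rel.sym)
  show "trans (adj_rel Q)"
    by (rule transI) (rule adj_rel.trans)
qed

lemma word_class_eq_iff:
  "u \<in> adj_words Q \<Longrightarrow> v \<in> adj_words Q \<Longrightarrow> word_class u = word_class v \<longleftrightarrow> (u, v) \<in> adj_rel Q"
  using eq_equiv_class_iff[OF equiv_adj_rel] by blast

lemma adj_rel_append:
  assumes "(u, u') \<in> adj_rel Q" "(v, v') \<in> adj_rel Q"
  shows "(u @ v, u' @ v') \<in> adj_rel Q"
proof -
  have "([] @ u @ v, [] @ u' @ v) \<in> adj_rel Q"
    using assms adj_rel_words by (intro adj_rel.cong) auto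
  moreover have "(u' @ v @ [], u' @ v' @ []) \<in> adj_rel Q"
    using assms adj_rel_words by (intro adj_rel.cong) auto
  ultimately show ?thesis
    using adj_rel.trans by fastforce
qed

lemma carrier_Adj: "carrier (Adj Q) = word_class ` adj_words Q"
  by (auto simp: Adj_def quotient_def)

lemma word_class_closed: "w \<in> adj_words Q \<Longrightarrow> word_class w \<in> carrier (Adj Q)"
  by (auto simp: carrier_Adj)

lemma one_Adj: "\<one>\<^bsub>Adj Q\<^esub> = word_class []"
  by (simp add: Adj_def)

lemma mult_word_class:
  assumes "u \<in> adj_words Q" "v \<in> adj_words Q"
  shows "word_class u \<cdot> word_class v = word_class (u @ v)"
proof -
  have "word_class (u' @ v') = word_class (u @ v)"
    if "u' \<in> word_class u" "v' \<in> word_class v" for u' v'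
    using that equiv_class_eq[OF equiv_adj_rel adj_rel_append] by blast
  moreover have "u \<in> word_class u" "v \<in> word_class v"
    using assms by (auto intro: adj_rel.refl)
  ultimately have "(\<Union>u'\<in>word_class u. \<Union>v'\<in>word_class v. word_class (u' @ v')) = word_class (u @ v)"
    by blast
  then show ?thesis
    by (simp add: Adj_def)
qed

text \<open>
  The inverse of a word is its reversal with all exponents negated; cancellation proceeds from the
  middle outwards.
\<close>

lemma inverse_word:
  "w \<in> adj_words Q \<Longrightarrow> (rev (map (\<lambda>(a, e). (a, \<not> e)) w) @ w, []) \<in> adj_rel Q"
proof (induction w)
  case Nil
  then show ?case by (simp add: adj_rel.refl)
next
  case (Cons l w)
  obtain a e where l: "l = (a, e)" by fastforce
  let ?v = "rev (map (\<lambda>(a, e). (a, \<not> e)) w)"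
  have vw: "(?v @ w, []) \<in> adj_rel Q"
    using Cons by simp
  have "(?v @ [(a, \<not> e), (a, \<not> \<not> e)] @ w, ?v @ [] @ w) \<in> adj_rel Q"
    using Cons.prems l adj_rel_words[OF vw] by (intro adj_rel.cong adj_rel.cancel) auto
  then show ?case
    using adj_rel.trans[OF _ vw] l by simp
qed

lemma group_Adj: "group (Adj Q)"
proof (rule groupI)
  fix g assume "g \<in> carrier (Adj Q)"
  then obtain w where w: "w \<in> adj_words Q" "g = word_class w"
    by (auto simp: carrier_Adj)
  let ?v = "rev (map (\<lambda>(a, e). (a, \<not> e)) w)"
  have "?v \<in> adj_words Q"
    using adj_rel_words[OF inverse_word[OF w(1)]] by simp
  moreover from this have "word_class ?v \<cdot> g = \<one>\<^bsub>Adj Q\<^esub>"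
    using w inverse_word[OF w(1)] by (simp add: mult_word_class one_Adj word_class_eq_iff)
  ultimately show "\<exists>h\<in>carrier (Adj Q). h \<cdot> g = \<one>\<^bsub>Adj Q\<^esub>"
    using word_class_closed by blast
qed (auto simp: carrier_Adj one_Adj mult_word_class)

sublocale Adj: group "Adj Q"
  by (rule group_Adj)

lemma adj_closed [simp]: "a \<in> carrier Q \<Longrightarrow> adj_gen a \<in> carrier (Adj Q)"
  by (auto simp: adj_def intro: word_class_closed)

lemma inv_adj: "a \<in> carrier Q \<Longrightarrow> (adj_gen a)\<^sup>\<inverse> = word_class [(a, False)]"
  using adj_rel.cancel[of a Q False]
  by (intro Adj.inv_equality)
    (auto simp: adj_def mult_word_class one_Adj word_class_eq_iff word_class_closed)

lemma adj_conj:
  "a \<in> carrier Q \<Longrightarrow> b \<in> carrier Q \<Longrightarrow>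
   adj_gen (a \<triangleright> b) = (adj_gen b)\<^sup>\<inverse> \<cdot> adj_gen a \<cdot> adj_gen b"
  by (simp add: inv_adj) (simp add: adj_def mult_word_class word_class_eq_iff op_closed adj_rel.conj)

text \<open>
  Every element of the adjoint group is reached from the neutral element by multiplying with
  generators and their inverses on the right. For right actions this is the convenient
  form of induction, because each step is a single translation.
\<close>

lemma Adj_induct [consumes 1, case_names one adj inv_adj]:
  assumes "g \<in> carrier (Adj Q)"
    and "P \<one>\<^bsub>Adj Q\<^esub>"
    and "\<And>g b. g \<in> carrier (Adj Q) \<Longrightarrow> b \<in> carrier Q \<Longrightarrow> P g \<Longrightarrow> P (g \<cdot> adj_gen b)"
    and "\<And>g b. g \<in> carrier (Adj Q) \<Longrightarrow> b \<in> carrier Q \<Longrightarrow> P g \<Longrightarrow> P (g \<cdot> (adj_gen b)\<^sup>\<inverse>)"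
  shows "P g"
proof -
  have "P (word_class w)" if "w \<in> adj_words Q" for w
    using that
  proof (induction w rule: rev_induct)
    case Nil
    then show ?case using assms(2) by (simp add: one_Adj)
  next
    case (snoc l w)
    then have "word_class (w @ [l]) = word_class w \<cdot> word_class [l]"
      by (simp add: mult_word_class)
    moreover have "word_class [l] = (if snd l then adj_gen (fst l) else (adj_gen (fst l))\<^sup>\<inverse>)"
      using snoc.prems inv_adj[of "fst l"] by (cases l) (simp add: adj_def)
    ultimately show ?case
      using snoc assms(3,4) by (auto simp: word_class_closed)
  qed
  then show ?thesis
    using assms(1) by (auto simp: carrier_Adj)
qed

lemma some_word:
  assumes "w \<in> adj_words Q"
  shows "(w, SOME v. v \<in> word_class w) \<in> adj_rel Q"
proof -
  have "w \<in> word_class w"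
    using assms by (auto intro: adj_rel.refl)
  then have "(SOME v. v \<in> word_class w) \<in> word_class w"
    by (rule someI)
  then show ?thesis by simp
qed

lemma adj_eps_word_class:
  assumes "w \<in> adj_words Q"
  shows "adj_eps (word_class w) = (\<Sum>(a, e)\<leftarrow>w. if e then 1 else - 1)"
proof -
  have "(\<Sum>(a, e)\<leftarrow>u. if e then 1 else - 1 :: int) = (\<Sum>(a, e)\<leftarrow>v. if e then 1 else - 1)"
    if "(u, v) \<in> adj_rel Q" for u v
    using that by induction auto
  then show ?thesis
    using some_word[OF assms] by (simp add: adj_eps_def)
qed

lemma adj_eps_mult:
  "g \<in> carrier (Adj Q) \<Longrightarrow> h \<in> carrier (Adj Q) \<Longrightarrow> adj_eps (g \<cdot> h) = adj_eps g + adj_eps h"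
  by (auto simp: carrier_Adj mult_word_class adj_eps_word_class)

lemma adj_eps_one: "adj_eps \<one>\<^bsub>Adj Q\<^esub> = 0"
  by (simp add: one_Adj adj_eps_word_class)

lemma adj_eps_inv: "g \<in> carrier (Adj Q) \<Longrightarrow> adj_eps (g\<^sup>\<inverse>) = - adj_eps g"
  using adj_eps_mult[of "g\<^sup>\<inverse>" g] by (simp add: adj_eps_one)

lemma adj_eps_adj: "a \<in> carrier Q \<Longrightarrow> adj_eps (adj_gen a) = 1"
  by (simp add: adj_def adj_eps_word_class)

lemma Adj0_iff: "g \<in> Adj0 Q \<longleftrightarrow> g \<in> carrier (Adj Q) \<and> adj_eps g = 0"
  by (auto simp: Adj0_def kernel_def integer_group_def)

end

section \<open>Actions of the adjoint group\<close>

text \<open>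
  The action on \<open>Q\<close> itself and the action on a covering are both instances of the following
  situation: the generator \<open>adj b\<close> translates by \<open>s b\<close>. The condition on \<open>s\<close>
  is about translations because a section of a covering is in general not a homomorphism.
\<close>

locale adj_action = quandle Q + R: quandle R
  for Q :: "('a, 'm) quandle_scheme" (structure) and R :: "('b, 'n) quandle_scheme" +
  fixes s :: "'a \<Rightarrow> 'b"
  assumes s_closed: "b \<in> carrier Q \<Longrightarrow> s b \<in> carrier R"
    and s_op: "a \<in> carrier Q \<Longrightarrow> b \<in> carrier Q \<Longrightarrow> x \<in> carrier R \<Longrightarrow>
      x \<triangleright>\<^bsub>R\<^esub> s (a \<triangleright> b) = x \<triangleright>\<^bsub>R\<^esub> (s a \<triangleright>\<^bsub>R\<^esub> s b)"
begin

lemma foldl_letter_act_closed: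
  "w \<in> adj_words Q \<Longrightarrow> x \<in> carrier R \<Longrightarrow> foldl (letter_act R s) x w \<in> carrier R"
  by (induction w arbitrary: x) (auto simp: letter_act_def s_closed R.op_closed R.bar_closed)

text \<open>
  Free cancellation is respected because \<open>\<triangleleft>\<close> inverts \<open>\<triangleright>\<close>, and the conjugation relation because of
  self-distributivity, applied after writing \<open>x = (x \<triangleleft> s b) \<triangleright> s b\<close>.
\<close>

lemma foldl_letter_act_adj_rel:
  "(u, v) \<in> adj_rel Q \<Longrightarrow> x \<in> carrier R \<Longrightarrow>
   foldl (letter_act R s) x u = foldl (letter_act R s) x v"
proof (induction arbitrary: x rule: adj_rel.induct)
  case (cong u v w t)
  then show ?case by (simp add: foldl_letter_act_closed)
next
  case (cancel a e)
  then show ?case by (cases e) (auto simp: letter_act_def s_closed R.op_bar R.bar_op)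
next
  case (conj a b)
  let ?y = "x \<triangleleft>\<^bsub>R\<^esub> s b"
  have y: "?y \<in> carrier R"
    using conj s_closed R.bar_closed by simp
  have "x \<triangleright>\<^bsub>R\<^esub> s (a \<triangleright> b) = (?y \<triangleright>\<^bsub>R\<^esub> s b) \<triangleright>\<^bsub>R\<^esub> (s a \<triangleright>\<^bsub>R\<^esub> s b)"
    using conj s_op s_closed R.bar_op by simp
  also have "\<dots> = (?y \<triangleright>\<^bsub>R\<^esub> s a) \<triangleright>\<^bsub>R\<^esub> s b"
    using R.distrib[of ?y "s a" "s b"] conj y s_closed by simp
  finally show ?case by (simp add: letter_act_def)
qed auto

lemma adj_act_word_class:
  assumes "w \<in> adj_words Q" "x \<in> carrier R"
  shows "adj_act R s x (word_class w) = foldl (letter_act R s) x w"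
  using foldl_letter_act_adj_rel[OF some_word[OF assms(1)] assms(2)] by (simp add: adj_act_def)

lemma adj_act_closed:
  "g \<in> carrier (Adj Q) \<Longrightarrow> x \<in> carrier R \<Longrightarrow> adj_act R s x g \<in> carrier R"
  by (auto simp: carrier_Adj adj_act_word_class foldl_letter_act_closed)

lemma adj_act_one: "x \<in> carrier R \<Longrightarrow> adj_act R s x \<one>\<^bsub>Adj Q\<^esub> = x"
  by (simp add: one_Adj adj_act_word_class)

lemma adj_act_mult:
  "g \<in> carrier (Adj Q) \<Longrightarrow> h \<in> carrier (Adj Q) \<Longrightarrow> x \<in> carrier R \<Longrightarrow>
   adj_act R s x (g \<cdot> h) = adj_act R s (adj_act R s x g) h"
  by (auto simp: carrier_Adj mult_word_class adj_act_word_class foldl_letter_act_closed)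

lemma adj_act_adj:
  "b \<in> carrier Q \<Longrightarrow> x \<in> carrier R \<Longrightarrow> adj_act R s x (adj_gen b) = x \<triangleright>\<^bsub>R\<^esub> s b"
  by (simp add: adj_def adj_act_word_class letter_act_def)

lemma adj_act_inv_adj:
  "b \<in> carrier Q \<Longrightarrow> x \<in> carrier R \<Longrightarrow> adj_act R s x ((adj_gen b)\<^sup>\<inverse>) = x \<triangleleft>\<^bsub>R\<^esub> s b"
  by (simp add: inv_adj adj_act_word_class letter_act_def)

lemma adj_act_mult_inv:
  "g \<in> carrier (Adj Q) \<Longrightarrow> x \<in> carrier R \<Longrightarrow> adj_act R s (adj_act R s x g) (g\<^sup>\<inverse>) = x"
  "g \<in> carrier (Adj Q) \<Longrightarrow> x \<in> carrier R \<Longrightarrow> adj_act R s (adj_act R s x (g\<^sup>\<inverse>)) g = x"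
  by (simp_all flip: adj_act_mult add: adj_act_one)

end

lemma quandle_hom_closed: "f \<in> quandle_hom P R \<Longrightarrow> x \<in> carrier P \<Longrightarrow> f x \<in> carrier R"
  by (auto simp: quandle_hom_def)

lemma quandle_hom_op:
  "f \<in> quandle_hom P R \<Longrightarrow> x \<in> carrier P \<Longrightarrow> y \<in> carrier P \<Longrightarrow>
   f (x \<triangleright>\<^bsub>P\<^esub> y) = f x \<triangleright>\<^bsub>R\<^esub> f y"
  by (auto simp: quandle_hom_def)

lemma quandle_hom_bar:
  assumes "quandle P" "quandle R" "f \<in> quandle_hom P R" "x \<in> carrier P" "y \<in> carrier P"
  shows "f (x \<triangleleft>\<^bsub>P\<^esub> y) = f x \<triangleleft>\<^bsub>R\<^esub> f y"
proof -
  interpret P: quandle P by fact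
  interpret R: quandle R by fact
  have "f x = f (x \<triangleleft>\<^bsub>P\<^esub> y) \<triangleright>\<^bsub>R\<^esub> f y"
    using assms P.bar_op[of x y] P.bar_closed quandle_hom_op[OF assms(3), of "x \<triangleleft>\<^bsub>P\<^esub> y" y] by simp
  then show ?thesis
    using assms P.bar_closed R.op_bar quandle_hom_closed[OF assms(3)] by simp
qed

text \<open>\<open>\<triangleleft> y\<close> is the inverse of \<open>\<triangleright> y\<close>, hence determined by it.\<close>

lemma (in quandle) bar_cong:
  assumes eq: "\<And>x. x \<in> carrier Q \<Longrightarrow> x \<triangleright> y = x \<triangleright> z"
    and "x \<in> carrier Q" "y \<in> carrier Q" "z \<in> carrier Q"
  shows "x \<triangleleft> y = x \<triangleleft> z"
  using assms eq[of "x \<triangleleft> y"] op_bar[of "x \<triangleleft> y" z] bar_op[of x y] bar_closed by metis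

text \<open>
  Both the projection of a covering and a morphism between coverings are of this kind: they send
  the translating element of the source to one that translates like that of the target.
\<close>

lemma adj_act_equivariant:
  assumes "adj_action Q R s" "adj_action Q R' s'" and f: "f \<in> quandle_hom R R'"
    and s: "\<And>b x. b \<in> carrier Q \<Longrightarrow> x \<in> carrier R' \<Longrightarrow> x \<triangleright>\<^bsub>R'\<^esub> f (s b) = x \<triangleright>\<^bsub>R'\<^esub> s' b"
    and g: "g \<in> carrier (Adj Q)" and x: "x \<in> carrier R"
  shows "f (adj_act R s x g) = adj_act R' s' (f x) g"
proof -
  interpret A: adj_action Q R s by fact
  interpret B: adj_action Q R' s' by fact
  note fc = quandle_hom_closed[OF f]
  show ?thesis using g
  proof (induction rule: A.Adj_induct)
    case one
    then show ?case using x fc by (simp add: A.adj_act_one B.adj_act_one)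
  next
    case (adj g b)
    then show ?case using x fc s quandle_hom_op[OF f]
      by (simp add: A.adj_act_mult B.adj_act_mult A.adj_act_adj B.adj_act_adj
          A.adj_act_closed B.adj_act_closed A.s_closed)
  next
    case (inv_adj g b)
    have "y \<triangleleft>\<^bsub>R'\<^esub> f (s b) = y \<triangleleft>\<^bsub>R'\<^esub> s' b" if "y \<in> carrier R'" for y
      using B.R.bar_cong[of "f (s b)" "s' b" y] that s inv_adj fc A.s_closed B.s_closed by simp
    then show ?case using x fc inv_adj
        quandle_hom_bar[OF A.R.quandle_axioms B.R.quandle_axioms f]
      by (simp add: A.adj_act_mult B.adj_act_mult A.adj_act_inv_adj B.adj_act_inv_adj
          A.adj_act_closed B.adj_act_closed A.s_closed)
  qed
qed

lemma is_coveringD: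
  assumes "is_covering Q P"
  shows "quandle P" "quandle Q" "proj P \<in> quandle_hom P Q"
    "proj P ` carrier P = carrier Q"
    "\<And>x y z. x \<in> carrier P \<Longrightarrow> y \<in> carrier P \<Longrightarrow> z \<in> carrier P \<Longrightarrow> proj P y = proj P z \<Longrightarrow>
       x \<triangleright>\<^bsub>P\<^esub> y = x \<triangleright>\<^bsub>P\<^esub> z"
  using assms unfolding is_covering_def by blast+

lemma covering_proj_closed: "is_covering Q P \<Longrightarrow> x \<in> carrier P \<Longrightarrow> proj P x \<in> carrier Q"
  by (rule quandle_hom_closed[OF is_coveringD(3)])

lemma covering_bar_cong:
  assumes "is_covering Q P" "x \<in> carrier P" "y \<in> carrier P" "z \<in> carrier P" "proj P y = proj P z"
  shows "x \<triangleleft>\<^bsub>P\<^esub> y = x \<triangleleft>\<^bsub>P\<^esub> z"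
  by (rule quandle.bar_cong[OF is_coveringD(1)[OF assms(1)] _ assms(2-4)])
    (rule is_coveringD(5)[OF assms(1) _ assms(3-5)])

lemma covering_section:
  assumes "is_covering Q P" "b \<in> carrier Q"
  shows "(SOME y. y \<in> carrier P \<and> proj P y = b) \<in> carrier P"
    and "proj P (SOME y. y \<in> carrier P \<and> proj P y = b) = b"
proof -
  have "\<exists>y. y \<in> carrier P \<and> proj P y = b"
    using is_coveringD(4)[OF assms(1)] assms(2) by (metis imageE)
  from someI_ex[OF this]
  show "(SOME y. y \<in> carrier P \<and> proj P y = b) \<in> carrier P"
    and "proj P (SOME y. y \<in> carrier P \<and> proj P y = b) = b" by auto
qed

text \<open>
  The chosen element over \<open>a \<triangleright> b\<close> and the product of those over \<open>a\<close> and \<open>b\<close> have the same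
  projection, so in a covering they induce the same translation.
\<close>

lemma covering_adj_action:
  assumes P: "is_covering Q P"
  shows "adj_action Q P (\<lambda>b. SOME y. y \<in> carrier P \<and> proj P y = b)"
proof -
  interpret P: quandle P using is_coveringD[OF P] by blast
  interpret Q: quandle Q using is_coveringD[OF P] by blast
  show ?thesis
  proof unfold_locales
    fix a b x assume "a \<in> carrier Q" "b \<in> carrier Q" "x \<in> carrier P"
    then show "x \<triangleright>\<^bsub>P\<^esub> (SOME y. y \<in> carrier P \<and> proj P y = a \<triangleright>\<^bsub>Q\<^esub> b) =
      x \<triangleright>\<^bsub>P\<^esub> ((SOME y. y \<in> carrier P \<and> proj P y = a) \<triangleright>\<^bsub>P\<^esub>
        (SOME y. y \<in> carrier P \<and> proj P y = b))"
      by (intro is_coveringD(5)[OF P])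
        (simp_all add: covering_section[OF P] Q.op_closed P.op_closed
          quandle_hom_op[OF is_coveringD(3)[OF P]])
  qed (rule covering_section[OF P])
qed

lemma cov_homD:
  assumes "\<phi> \<in> cov_hom P R"
  shows "\<phi> \<in> quandle_hom P R" "\<phi> \<in> extensional (carrier P)"
    "\<And>x. x \<in> carrier P \<Longrightarrow> proj R (\<phi> x) = proj P x"
    "\<And>x. x \<in> carrier P \<Longrightarrow> \<phi> x \<in> carrier R"
    "\<And>x y. x \<in> carrier P \<Longrightarrow> y \<in> carrier P \<Longrightarrow> \<phi> (x \<triangleright>\<^bsub>P\<^esub> y) = \<phi> x \<triangleright>\<^bsub>R\<^esub> \<phi> y"
  using assms by (auto simp: cov_hom_def quandle_hom_def)

context
  fixes Q :: "('a, 'm) quandle_scheme" and P :: "('b, 'a, 'n) covering_scheme"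
  assumes P: "is_covering Q P"
begin

interpretation A: adj_action Q P "\<lambda>b. SOME y. y \<in> carrier P \<and> proj P y = b"
  by (rule covering_adj_action[OF P])

lemma cov_act_closed:
  "g \<in> carrier (Adj Q) \<Longrightarrow> x \<in> carrier P \<Longrightarrow> cov_act P x g \<in> carrier P"
  unfolding cov_act_def by (rule A.adj_act_closed)

lemma cov_act_one: "x \<in> carrier P \<Longrightarrow> cov_act P x \<one>\<^bsub>Adj Q\<^esub> = x"
  unfolding cov_act_def by (rule A.adj_act_one)

lemma cov_act_mult:
  "g \<in> carrier (Adj Q) \<Longrightarrow> h \<in> carrier (Adj Q) \<Longrightarrow> x \<in> carrier P \<Longrightarrow>
   cov_act P x (g \<otimes>\<^bsub>Adj Q\<^esub> h) = cov_act P (cov_act P x g) h"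
  unfolding cov_act_def by (rule A.adj_act_mult)

lemma cov_act_mult_inv:
  "g \<in> carrier (Adj Q) \<Longrightarrow> x \<in> carrier P \<Longrightarrow> cov_act P (cov_act P x g) (inv\<^bsub>Adj Q\<^esub> g) = x"
  "g \<in> carrier (Adj Q) \<Longrightarrow> x \<in> carrier P \<Longrightarrow> cov_act P (cov_act P x (inv\<^bsub>Adj Q\<^esub> g)) g = x"
  unfolding cov_act_def by (rule A.adj_act_mult_inv; assumption)+

text \<open>
  The action does not depend on the chosen elements over the points of \<open>Q\<close>.
\<close>

lemma cov_act_adj:
  assumes "x \<in> carrier P" "y \<in> carrier P" "proj P y = b"
  shows "cov_act P x (adj Q b) = x \<triangleright>\<^bsub>P\<^esub> y"
proof -
  have b: "b \<in> carrier Q" using assms covering_proj_closed[OF P] by auto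
  have "cov_act P x (adj Q b) = x \<triangleright>\<^bsub>P\<^esub> (SOME y. y \<in> carrier P \<and> proj P y = b)"
    unfolding cov_act_def by (rule A.adj_act_adj[OF b assms(1)])
  also have "\<dots> = x \<triangleright>\<^bsub>P\<^esub> y"
    by (rule is_coveringD(5)[OF P assms(1) covering_section(1)[OF P b] assms(2)])
      (simp only: covering_section(2)[OF P b] assms(3))
  finally show ?thesis .
qed

lemma cov_act_inv_adj:
  assumes "x \<in> carrier P" "y \<in> carrier P" "proj P y = b"
  shows "cov_act P x (inv\<^bsub>Adj Q\<^esub> adj Q b) = x \<triangleleft>\<^bsub>P\<^esub> y"
proof -
  have b: "b \<in> carrier Q" using assms covering_proj_closed[OF P] by auto
  have "cov_act P x (inv\<^bsub>Adj Q\<^esub> adj Q b) = x \<triangleleft>\<^bsub>P\<^esub> (SOME y. y \<in> carrier P \<and> proj P y = b)"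
    unfolding cov_act_def by (rule A.adj_act_inv_adj[OF b assms(1)])
  also have "\<dots> = x \<triangleleft>\<^bsub>P\<^esub> y"
    by (rule covering_bar_cong[OF P assms(1) covering_section(1)[OF P b] assms(2)])
      (simp only: covering_section(2)[OF P b] assms(3))
  finally show ?thesis .
qed

end

lemma cov_hom_equivariant:
  assumes P: "is_covering Q P" and R: "is_covering Q R" and \<phi>: "\<phi> \<in> cov_hom P R"
    and g: "g \<in> carrier (Adj Q)" and x: "x \<in> carrier P"
  shows "\<phi> (cov_act P x g) = cov_act R (\<phi> x) g"
  unfolding cov_act_def
proof (rule adj_act_equivariant[OF covering_adj_action[OF P] covering_adj_action[OF R] _ _ g x])
  show "\<phi> \<in> quandle_hom P R" by (rule cov_homD(1)[OF \<phi>])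
  show "y \<triangleright>\<^bsub>R\<^esub> \<phi> (SOME z. z \<in> carrier P \<and> proj P z = b) =
      y \<triangleright>\<^bsub>R\<^esub> (SOME z. z \<in> carrier R \<and> proj R z = b)"
    if "b \<in> carrier Q" "y \<in> carrier R" for b y
  proof (rule is_coveringD(5)[OF R that(2) cov_homD(4)[OF \<phi>]])
    show "proj R (\<phi> (SOME z. z \<in> carrier P \<and> proj P z = b)) =
        proj R (SOME z. z \<in> carrier R \<and> proj R z = b)"
      using cov_homD(3)[OF \<phi> covering_section(1)[OF P that(1)]]
        covering_section(2)[OF P that(1)] covering_section(2)[OF R that(1)] by simp
  qed (rule covering_section(1)[OF P that(1)], rule covering_section(1)[OF R that(1)])
qed

context quandle
begin

lemma adj_action_self: "adj_action Q Q (\<lambda>b. b)"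
  by unfold_locales auto

interpretation self: adj_action Q Q "\<lambda>b. b"
  by (rule adj_action_self)

lemma quandle_act_closed [simp]:
  "g \<in> carrier (Adj Q) \<Longrightarrow> x \<in> carrier Q \<Longrightarrow> quandle_act Q x g \<in> carrier Q"
  unfolding quandle_act_def by (rule self.adj_act_closed)

lemma quandle_act_one [simp]: "x \<in> carrier Q \<Longrightarrow> quandle_act Q x \<one>\<^bsub>Adj Q\<^esub> = x"
  unfolding quandle_act_def by (rule self.adj_act_one)

lemma quandle_act_mult [simp]:
  "g \<in> carrier (Adj Q) \<Longrightarrow> h \<in> carrier (Adj Q) \<Longrightarrow> x \<in> carrier Q \<Longrightarrow>
   quandle_act Q x (g \<cdot> h) = quandle_act Q (quandle_act Q x g) h"
  unfolding quandle_act_def by (rule self.adj_act_mult)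

lemma quandle_act_mult_inv [simp]:
  "g \<in> carrier (Adj Q) \<Longrightarrow> x \<in> carrier Q \<Longrightarrow> quandle_act Q (quandle_act Q x g) (g\<^sup>\<inverse>) = x"
  "g \<in> carrier (Adj Q) \<Longrightarrow> x \<in> carrier Q \<Longrightarrow> quandle_act Q (quandle_act Q x (g\<^sup>\<inverse>)) g = x"
  unfolding quandle_act_def by (rule self.adj_act_mult_inv; assumption)+

lemma quandle_act_adj [simp]:
  "b \<in> carrier Q \<Longrightarrow> x \<in> carrier Q \<Longrightarrow> quandle_act Q x (adj_gen b) = x \<triangleright> b"
  unfolding quandle_act_def by (rule self.adj_act_adj)

lemma quandle_act_inv_adj [simp]:
  "b \<in> carrier Q \<Longrightarrow> x \<in> carrier Q \<Longrightarrow> quandle_act Q x ((adj_gen b)\<^sup>\<inverse>) = x \<triangleleft> b"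
  unfolding quandle_act_def by (rule self.adj_act_inv_adj)

lemma proj_cov_act:
  assumes P: "is_covering Q P" and g: "g \<in> carrier (Adj Q)" and x: "x \<in> carrier P"
  shows "proj P (cov_act P x g) = quandle_act Q (proj P x) g"
  unfolding cov_act_def quandle_act_def
  using covering_section[OF P]
  by (intro adj_act_equivariant[OF covering_adj_action[OF P] adj_action_self _ _ g x])
    (auto simp: is_coveringD(3)[OF P])

lemma Adj_cancel [simp]:
  "g \<in> carrier (Adj Q) \<Longrightarrow> h \<in> carrier (Adj Q) \<Longrightarrow> g \<cdot> (g\<^sup>\<inverse> \<cdot> h) = h"
  "g \<in> carrier (Adj Q) \<Longrightarrow> h \<in> carrier (Adj Q) \<Longrightarrow> g\<^sup>\<inverse> \<cdot> (g \<cdot> h) = h"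
  by (simp_all flip: Adj.m_assoc)

lemma idem_bar: "a \<in> carrier Q \<Longrightarrow> a \<triangleleft> a = a"
  using op_bar[of a a] idem by simp

lemma adj_bar:
  assumes "a \<in> carrier Q" "b \<in> carrier Q"
  shows "adj_gen (a \<triangleleft> b) = adj_gen b \<cdot> adj_gen a \<cdot> (adj_gen b)\<^sup>\<inverse>"
  using adj_conj[of "a \<triangleleft> b" b] assms bar_closed
  by (simp add: bar_op Adj.m_assoc)

text \<open>
  The defining relation extends from generators to all elements acting on \<open>Q\<close>.
\<close>

lemma adj_quandle_act:
  assumes "g \<in> carrier (Adj Q)" "a \<in> carrier Q"
  shows "adj_gen (quandle_act Q a g) = g\<^sup>\<inverse> \<cdot> adj_gen a \<cdot> g"
  using assms
  by (induction rule: Adj_induct)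
    (simp_all add: adj_conj adj_bar Adj.m_assoc Adj.inv_mult_group)

end

section \<open>Transitivity on a connected quandle\<close>

context connected_quandle
begin

lemma translation_Bij: "a \<in> carrier Q \<Longrightarrow> (\<lambda>x\<in>carrier Q. x \<triangleright> a) \<in> Bij (carrier Q)"
  unfolding Bij_def
  by (auto intro!: bij_betw_byWitness[where f' = "\<lambda>x. x \<triangleleft> a"] simp: op_bar bar_op op_closed bar_closed)

lemma Inn_subset_Bij: "Inn Q \<subseteq> Bij (carrier Q)"
  using group.generate_incl[OF group_BijGroup, of "(\<lambda>a. \<lambda>x\<in>carrier Q. x \<triangleright> a) ` carrier Q" "carrier Q"]
    translation_Bij
  by (auto simp: Inn_def BijGroup_def)

text \<open>
  Generators of \<open>Inn Q\<close> act like generators of \<open>Adj Q\<close>, so both groups have the same orbits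
  on \<open>Q\<close>, and connectedness can be used for \<open>Adj Q\<close>.
\<close>

lemma Inn_by_Adj:
  assumes "f \<in> Inn Q" "x \<in> carrier Q"
  shows "\<exists>g\<in>carrier (Adj Q). f x = quandle_act Q x g"
  using assms unfolding Inn_def
proof (induction arbitrary: x rule: generate.induct)
  case one
  then show ?case by (intro bexI[of _ "\<one>\<^bsub>Adj Q\<^esub>"]) (auto simp: BijGroup_def)
next
  case (incl h)
  then obtain a where a: "a \<in> carrier Q" "h = (\<lambda>x\<in>carrier Q. x \<triangleright> a)" by auto
  then show ?case
    using incl.prems by (intro bexI[of _ "adj_gen a"]) auto
next
  case (inv h)
  then obtain a where a: "a \<in> carrier Q" "h = (\<lambda>x\<in>carrier Q. x \<triangleright> a)" by auto
  have "inv_into (carrier Q) h x = x \<triangleleft> a"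
    using a inv.prems translation_Bij[OF a(1)] bar_closed bar_op
    by (intro inv_into_f_eq) (auto simp: Bij_def bij_betw_def)
  then show ?case
    using a inv.prems translation_Bij[OF a(1)]
    by (intro bexI[of _ "(adj_gen a)\<^sup>\<inverse>"]) (auto simp: inv_BijGroup)
next
  case (eng h1 h2)
  have B: "h1 \<in> Bij (carrier Q)" "h2 \<in> Bij (carrier Q)"
    using eng.hyps Inn_subset_Bij unfolding Inn_def by auto
  obtain g where g: "g \<in> carrier (Adj Q)" "h2 x = quandle_act Q x g"
    using eng by blast
  moreover obtain g' where g': "g' \<in> carrier (Adj Q)" "h1 (h2 x) = quandle_act Q (h2 x) g'"
    using eng.IH(1)[of "h2 x"] g eng.prems by auto
  ultimately show ?case
    using eng.prems B
    by (intro bexI[of _ "g \<cdot> g'"]) (auto simp: BijGroup_def compose_eq)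
qed

end

locale pointed_connected_quandle = connected_quandle Q
  for Q :: "('a, 'm) quandle_scheme" (structure) +
  fixes q :: 'a
  assumes base [simp]: "q \<in> carrier Q"
begin

lemma Adj0_closed [simp]: "g \<in> Adj0 Q \<Longrightarrow> g \<in> carrier (Adj Q)"
  by (simp add: Adj0_iff)

lemma Adj0_mult [simp]: "g \<in> Adj0 Q \<Longrightarrow> h \<in> Adj0 Q \<Longrightarrow> g \<cdot> h \<in> Adj0 Q"
  by (simp add: Adj0_iff adj_eps_mult)

lemma Adj0_one [simp]: "\<one>\<^bsub>Adj Q\<^esub> \<in> Adj0 Q"
  by (simp add: Adj0_iff adj_eps_one)

lemma Adj0_inv [simp]: "g \<in> Adj0 Q \<Longrightarrow> g\<^sup>\<inverse> \<in> Adj0 Q"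
  by (simp add: Adj0_iff adj_eps_inv)

text \<open>
  Since \<open>q\<close> is idempotent, multiplying with \<open>adj q\<close> or its inverse on the left does not change where
  \<open>q\<close> is sent, but it shifts the degree. Hence every step of the induction can be compensated
  to stay in degree zero.
\<close>

lemma Adj0_same_orbit:
  assumes "g \<in> carrier (Adj Q)"
  shows "\<exists>h\<in>Adj0 Q. quandle_act Q q h = quandle_act Q q g"
  using assms
proof (induction rule: Adj_induct)
  case one
  then show ?case by (intro bexI[of _ "\<one>\<^bsub>Adj Q\<^esub>"]) auto
next
  case (adj g b)
  from adj.IH obtain h where h: "h \<in> Adj0 Q" "quandle_act Q q h = quandle_act Q q g"
    by (rule bexE)
  with adj.hyps show ?case
    by (intro bexI[of _ "(adj_gen q)\<^sup>\<inverse> \<cdot> h \<cdot> adj_gen b"])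
      (simp_all add: Adj0_iff adj_eps_mult adj_eps_inv adj_eps_adj idem_bar del: Adj0_closed)
next
  case (inv_adj g b)
  from inv_adj.IH obtain h where h: "h \<in> Adj0 Q" "quandle_act Q q h = quandle_act Q q g"
    by (rule bexE)
  with inv_adj.hyps show ?case
    by (intro bexI[of _ "adj_gen q \<cdot> h \<cdot> (adj_gen b)\<^sup>\<inverse>"])
      (simp_all add: Adj0_iff adj_eps_mult adj_eps_inv adj_eps_adj idem del: Adj0_closed)
qed

lemma Adj0_transitive:
  assumes "a \<in> carrier Q"
  obtains g where "g \<in> Adj0 Q" "quandle_act Q q g = a"
  using Inn_transitive[OF base assms] Inn_by_Adj[OF _ base] Adj0_same_orbit by metis

section \<open>The universal covering\<close>

abbreviation "U \<equiv> univ_cov Q q"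

lemma univ_carrier: "(a, g) \<in> carrier U \<longleftrightarrow> g \<in> Adj0 Q \<and> a = quandle_act Q q g"
  by (auto simp: univ_cov_def)

lemma univ_op: "(a, g) \<triangleright>\<^bsub>U\<^esub> (b, h) = (a \<triangleright> b, g \<cdot> (adj_gen a)\<^sup>\<inverse> \<cdot> adj_gen b)"
  by (simp add: univ_cov_def)

lemma univ_bar: "(a, g) \<triangleleft>\<^bsub>U\<^esub> (b, h) = (a \<triangleleft> b, g \<cdot> adj_gen a \<cdot> (adj_gen b)\<^sup>\<inverse>)"
  by (simp add: univ_cov_def)

lemma univ_proj [simp]: "proj U = fst"
  by (simp add: univ_cov_def)

lemma univ_cases:
  assumes "z \<in> carrier U"
  obtains g where "z = (quandle_act Q q g, g)" "g \<in> Adj0 Q" "g \<in> carrier (Adj Q)"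
    "quandle_act Q q g \<in> carrier Q"
  using assms by (cases z) (auto simp: univ_carrier)

lemma univ_op_closed:
  assumes "z \<in> carrier U" "w \<in> carrier U"
  shows "z \<triangleright>\<^bsub>U\<^esub> w \<in> carrier U" "z \<triangleleft>\<^bsub>U\<^esub> w \<in> carrier U"
  using assms
  by (auto elim!: univ_cases simp: univ_op univ_bar univ_carrier Adj0_iff adj_eps_mult adj_eps_inv
      adj_eps_adj idem idem_bar simp del: Adj0_closed)

text \<open>
  The first components satisfy the laws of \<open>Q\<close>. In the second component each law becomes an identity
  in \<open>Adj Q\<close> after \<open>adj (a \<triangleright> b)\<close> and \<open>adj (a \<triangleleft> b)\<close> are expanded as conjugates.
\<close>

lemma quandle_univ: "quandle U"
proof
  fix x y z assume "x \<in> carrier U" "y \<in> carrier U"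
  then show "x \<triangleright>\<^bsub>U\<^esub> x = x" "(x \<triangleright>\<^bsub>U\<^esub> y) \<triangleleft>\<^bsub>U\<^esub> y = x" "(x \<triangleleft>\<^bsub>U\<^esub> y) \<triangleright>\<^bsub>U\<^esub> y = x"
    by (auto elim!: univ_cases simp: univ_op univ_bar idem op_bar bar_op
        adj_conj adj_bar Adj.m_assoc Adj.inv_mult_group)
next
  fix x y z assume "x \<in> carrier U" "y \<in> carrier U" "z \<in> carrier U"
  then show "(x \<triangleright>\<^bsub>U\<^esub> y) \<triangleright>\<^bsub>U\<^esub> z = (x \<triangleright>\<^bsub>U\<^esub> z) \<triangleright>\<^bsub>U\<^esub> (y \<triangleright>\<^bsub>U\<^esub> z)"
    by (auto elim!: univ_cases intro!: distrib simp: univ_op adj_conj Adj.m_assoc Adj.inv_mult_group)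
qed (auto simp: univ_op_closed)

lemma is_covering_univ: "is_covering Q U"
  unfolding is_covering_def
proof (intro conjI ballI impI)
  show "proj U \<in> quandle_hom U Q"
    by (auto simp: quandle_hom_def univ_op elim!: univ_cases)
  show "proj U ` carrier U = carrier Q"
  proof
    show "carrier Q \<subseteq> proj U ` carrier U"
    proof
      fix a assume "a \<in> carrier Q"
      then obtain g where "g \<in> Adj0 Q" "quandle_act Q q g = a" by (rule Adj0_transitive)
      then have "(a, g) \<in> carrier U" by (simp add: univ_carrier)
      then show "a \<in> proj U ` carrier U" by force
    qed
  qed (auto elim!: univ_cases)
  fix x y z assume "proj U y = proj U z"
  then show "x \<triangleright>\<^bsub>U\<^esub> y = x \<triangleright>\<^bsub>U\<^esub> z"
    by (cases x; cases y; cases z) (simp add: univ_op)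
qed (auto simp: quandle_univ quandle_axioms)

text \<open>
  The adjoint group acts on the universal covering by right multiplication, corrected by
  a power of \<open>adj q\<close> on the left that restores degree zero. This rests on
  \<open>g \<cdot> (adj (q\<^sup>g))\<^sup>\<inverse> = (adj q)\<^sup>\<inverse> \<cdot> g\<close>, a case of \<open>adj_quandle_act\<close>. For elements of degree zero the
  correction disappears.
\<close>

lemma univ_cov_act:
  assumes "g \<in> carrier (Adj Q)"
  shows "cov_act U (q, \<one>\<^bsub>Adj Q\<^esub>) g =
    (quandle_act Q q g, adj_gen q [^]\<^bsub>Adj Q\<^esub> (- adj_eps g) \<cdot> g)"
  (is "cov_act U ?q1 g = _")
proof -
  note U = is_covering_univ
  have q1: "?q1 \<in> carrier U" by (simp add: univ_carrier)
  show ?thesis using assms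
  proof (induction rule: Adj_induct)
    case one
    then show ?case using q1 by (simp add: cov_act_one[OF U] adj_eps_one)
  next
    case (adj g b)
    \<comment> \<open>\<open>(b, h)\<close> is an element over \<open>b\<close>, so \<open>adj b\<close> acts by translation with it\<close>
    obtain h where h: "h \<in> Adj0 Q" "quandle_act Q q h = b" using adj(2) by (rule Adj0_transitive)
    let ?p = "adj_gen q [^]\<^bsub>Adj Q\<^esub> (- adj_eps g)"
    have "adj_gen q [^]\<^bsub>Adj Q\<^esub> (- adj_eps (g \<cdot> adj_gen b)) = ?p \<cdot> (adj_gen q)\<^sup>\<inverse>"
      using adj Adj.int_pow_mult[of "adj_gen q" "- adj_eps g" "-1"]
      by (simp add: adj_eps_mult adj_eps_adj Adj.int_pow_neg algebra_simps)
    moreover have "cov_act U ?q1 (g \<cdot> adj_gen b) = cov_act U ?q1 g \<triangleright>\<^bsub>U\<^esub> (b, h)"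
      using adj.hyps h q1 cov_act_adj[OF U cov_act_closed[OF U adj.hyps(1) q1], of "(b, h)" b]
      by (simp add: cov_act_mult[OF U] univ_carrier)
    ultimately show ?case
      using adj by (simp add: univ_op adj_quandle_act Adj.inv_mult_group Adj.m_assoc)
  next
    case (inv_adj g b)
    obtain h where h: "h \<in> Adj0 Q" "quandle_act Q q h = b" using inv_adj(2) by (rule Adj0_transitive)
    let ?p = "adj_gen q [^]\<^bsub>Adj Q\<^esub> (- adj_eps g)"
    have "adj_gen q [^]\<^bsub>Adj Q\<^esub> (- adj_eps (g \<cdot> (adj_gen b)\<^sup>\<inverse>)) = ?p \<cdot> adj_gen q"
      using inv_adj Adj.int_pow_mult[of "adj_gen q" "- adj_eps g" "1"]
      by (simp add: adj_eps_mult adj_eps_inv adj_eps_adj algebra_simps)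
    moreover have "cov_act U ?q1 (g \<cdot> (adj_gen b)\<^sup>\<inverse>) = cov_act U ?q1 g \<triangleleft>\<^bsub>U\<^esub> (b, h)"
      using inv_adj.hyps h q1
        cov_act_inv_adj[OF U cov_act_closed[OF U inv_adj.hyps(1) q1], of "(b, h)" b]
      by (simp add: cov_act_mult[OF U] univ_carrier)
    ultimately show ?case
      using inv_adj by (simp add: univ_bar adj_quandle_act Adj.inv_mult_group Adj.m_assoc)
  qed
qed

end

section \<open>The covering associated with an action\<close>

context pointed_connected_quandle
begin

lemma pi1_iff: "g \<in> carrier (pi1 Q q) \<longleftrightarrow> g \<in> Adj0 Q \<and> quandle_act Q q g = q"
  by (simp add: pi1_def)

lemma pi1_mult [simp]: "g \<otimes>\<^bsub>pi1 Q q\<^esub> h = g \<cdot> h"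
  by (simp add: pi1_def)

lemma pi1_one [simp]: "\<one>\<^bsub>pi1 Q q\<^esub> = \<one>\<^bsub>Adj Q\<^esub>"
  by (simp add: pi1_def)

lemma pi1_closed [simp]: "g \<in> carrier (pi1 Q q) \<Longrightarrow> g \<in> carrier (Adj Q)"
  by (simp add: pi1_iff)

lemma pi1_one_closed: "\<one>\<^bsub>Adj Q\<^esub> \<in> carrier (pi1 Q q)"
  by (simp add: pi1_iff)

lemma pi1_mult_closed:
  "g \<in> carrier (pi1 Q q) \<Longrightarrow> h \<in> carrier (pi1 Q q) \<Longrightarrow> g \<cdot> h \<in> carrier (pi1 Q q)"
  by (simp add: pi1_iff)

lemma pi1_inv_closed: "g \<in> carrier (pi1 Q q) \<Longrightarrow> g\<^sup>\<inverse> \<in> carrier (pi1 Q q)"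
  using quandle_act_mult_inv(1)[of g q] by (simp add: pi1_iff)

lemma base_point_closed: "(q, \<one>\<^bsub>Adj Q\<^esub>) \<in> carrier U"
  by (simp add: univ_carrier)

lemma deck_closed:
  "g \<in> carrier (pi1 Q q) \<Longrightarrow> z \<in> carrier U \<Longrightarrow> deck Q g z \<in> carrier U"
  by (auto elim!: univ_cases simp: deck_def univ_carrier pi1_iff)

lemma deck_one: "z \<in> carrier U \<Longrightarrow> deck Q \<one>\<^bsub>Adj Q\<^esub> z = z"
  by (auto elim!: univ_cases simp: deck_def)

lemma deck_mult:
  "g \<in> carrier (pi1 Q q) \<Longrightarrow> h \<in> carrier (pi1 Q q) \<Longrightarrow> z \<in> carrier U \<Longrightarrow>
   deck Q (g \<cdot> h) z = deck Q g (deck Q h z)"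
  by (auto elim!: univ_cases simp: deck_def Adj.m_assoc)

lemma deck_op:
  assumes "g \<in> carrier (pi1 Q q)" "h \<in> carrier (pi1 Q q)" "z \<in> carrier U" "w \<in> carrier U"
  shows "deck Q g z \<triangleright>\<^bsub>U\<^esub> deck Q h w = deck Q g (z \<triangleright>\<^bsub>U\<^esub> w)"
    and "deck Q g z \<triangleleft>\<^bsub>U\<^esub> deck Q h w = deck Q g (z \<triangleleft>\<^bsub>U\<^esub> w)"
  using assms by (auto elim!: univ_cases simp: deck_def univ_op univ_bar Adj.m_assoc)

end

locale pi1_set = pointed_connected_quandle +
  fixes X :: "('x, 'a adj) gset"
  assumes right_action: "right_action (pi1 Q q) X"
begin

abbreviation psi_class :: "'x \<Rightarrow> 'a \<times> 'a adj \<Rightarrow> ('x \<times> 'a \<times> 'a adj) set" where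
  "psi_class x z \<equiv> psi_rel Q q X `` {(x, z)}"

lemma act_closed: "x \<in> carrier X \<Longrightarrow> g \<in> carrier (pi1 Q q) \<Longrightarrow> act X x g \<in> carrier X"
  using right_action by (simp add: right_action_def)

lemma act_one: "x \<in> carrier X \<Longrightarrow> act X x \<one>\<^bsub>Adj Q\<^esub> = x"
  using right_action by (simp add: right_action_def)

lemma act_mult:
  "x \<in> carrier X \<Longrightarrow> g \<in> carrier (pi1 Q q) \<Longrightarrow> h \<in> carrier (pi1 Q q) \<Longrightarrow>
   act X x (g \<cdot> h) = act X (act X x g) h"
  using right_action by (simp add: right_action_def)

lemma psi_rel_iff:
  "((x, z), (y, w)) \<in> psi_rel Q q X \<longleftrightarrow>
   y \<in> carrier X \<and> z \<in> carrier U \<and> (\<exists>g\<in>carrier (pi1 Q q). x = act X y g \<and> w = deck Q g z)"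
  unfolding psi_rel_def by blast

text \<open>
  The classes are the orbits of the action of the fundamental group by
  \<open>(x, z) \<mapsto> (x\<^sup>g, g\<^sup>\<inverse> \<cdot> z)\<close>. This is why the relation, although only the generating one, is
  already an equivalence.
\<close>

lemma equiv_psi_rel: "equiv (carrier X \<times> carrier U) (psi_rel Q q X)"
proof (rule equivI)
  show "psi_rel Q q X \<subseteq> (carrier X \<times> carrier U) \<times> (carrier X \<times> carrier U)"
    by (auto simp: psi_rel_def act_closed deck_closed)
  show "refl_on (carrier X \<times> carrier U) (psi_rel Q q X)"
    using pi1_one_closed by (auto simp: refl_on_def psi_rel_iff act_one deck_one intro!: bexI)
  show "sym (psi_rel Q q X)"
  proof (rule symI)
    fix s t assume "(s, t) \<in> psi_rel Q q X"
    then obtain y z g where *: "s = (act X y g, z)" "t = (y, deck Q g z)"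
      "y \<in> carrier X" "g \<in> carrier (pi1 Q q)" "z \<in> carrier U"
      by (auto simp: psi_rel_def)
    then have "y = act X (act X y g) (g\<^sup>\<inverse>)" "z = deck Q (g\<^sup>\<inverse>) (deck Q g z)"
      using pi1_inv_closed[OF *(4)]
      by (simp_all flip: act_mult deck_mult add: act_one deck_one)
    then show "(t, s) \<in> psi_rel Q q X"
      using * pi1_inv_closed by (auto simp: psi_rel_iff act_closed deck_closed)
  qed
  show "trans (psi_rel Q q X)"
  proof (rule transI)
    fix r s t assume "(r, s) \<in> psi_rel Q q X" "(s, t) \<in> psi_rel Q q X"
    then obtain x z g h where *: "r = (act X (act X x h) g, z)" "t = (x, deck Q h (deck Q g z))"
      "x \<in> carrier X" "g \<in> carrier (pi1 Q q)" "h \<in> carrier (pi1 Q q)" "z \<in> carrier U"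
      by (auto simp: psi_rel_def)
    then have "r = (act X x (h \<cdot> g), z)" "t = (x, deck Q (h \<cdot> g) z)"
      by (simp_all add: act_mult deck_mult)
    with *(3,6) pi1_mult_closed[OF *(5,4)] show "(r, t) \<in> psi_rel Q q X"
      unfolding psi_rel_def by blast
  qed
qed

lemma psi_class_eq_iff:
  assumes "x \<in> carrier X" "z \<in> carrier U" "y \<in> carrier X" "w \<in> carrier U"
  shows "psi_class x z = psi_class y w \<longleftrightarrow>
    (\<exists>g\<in>carrier (pi1 Q q). x = act X y g \<and> w = deck Q g z)"
  using eq_equiv_class_iff[OF equiv_psi_rel, of "(x, z)" "(y, w)"] assms
  by (simp add: psi_rel_iff)

lemma psi_class_deck:
  assumes "x \<in> carrier X" "z \<in> carrier U" "g \<in> carrier (pi1 Q q)"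
  shows "psi_class (act X x g) z = psi_class x (deck Q g z)"
  using assms by (auto simp: psi_class_eq_iff act_closed deck_closed)

lemma psi_class_self: "x \<in> carrier X \<Longrightarrow> z \<in> carrier U \<Longrightarrow> (x, z) \<in> psi_class x z"
  using equiv_class_self[OF equiv_psi_rel] by blast

lemma psi_class_closed:
  "x \<in> carrier X \<Longrightarrow> z \<in> carrier U \<Longrightarrow> psi_class x z \<in> carrier (psi_cov Q q X)"
  by (auto simp: psi_cov_def quotientI)

lemma psi_cases:
  assumes "A \<in> carrier (psi_cov Q q X)"
  obtains x z where "A = psi_class x z" "x \<in> carrier X" "z \<in> carrier U"
  using assms by (auto simp: psi_cov_def elim!: quotientE)

lemma mem_psi_class:
  assumes "(y, w) \<in> psi_class x z"
  obtains g where "g \<in> carrier (pi1 Q q)" "x = act X y g" "w = deck Q g z"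
    "y \<in> carrier X" "z \<in> carrier U" "w \<in> carrier U"
  using assms by (auto simp: psi_rel_iff deck_closed)

text \<open>
  The operations on classes and the maps induced on them are unions over all representatives. If the
  value is the same for each of them, the union is this value.
\<close>

lemma UN_psi_class:
  assumes "x \<in> carrier X" "z \<in> carrier U"
    and "\<And>y g. y \<in> carrier X \<Longrightarrow> g \<in> carrier (pi1 Q q) \<Longrightarrow> x = act X y g \<Longrightarrow> f y (deck Q g z) = C"
  shows "(\<Union>(y, w)\<in>psi_class x z. f y w) = C"
proof -
  have "f y w = C" if "(y, w) \<in> psi_class x z" for y w
    using that assms(3) by (elim mem_psi_class) blast
  moreover have "(x, z) \<in> psi_class x z"
    using assms psi_class_self by blast
  ultimately show ?thesis by blast
qed

lemma psi_op:
  assumes "x \<in> carrier X" "z \<in> carrier U" "y \<in> carrier X" "w \<in> carrier U"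
  shows "psi_class x z \<triangleright>\<^bsub>psi_cov Q q X\<^esub> psi_class y w = psi_class x (z \<triangleright>\<^bsub>U\<^esub> w)"
    and "psi_class x z \<triangleleft>\<^bsub>psi_cov Q q X\<^esub> psi_class y w = psi_class x (z \<triangleleft>\<^bsub>U\<^esub> w)"
proof -
  have "(\<Union>(x, z)\<in>psi_class x z. \<Union>(y, w)\<in>psi_class y w. psi_class x (z \<triangleright>\<^bsub>U\<^esub> w)) =
      psi_class x (z \<triangleright>\<^bsub>U\<^esub> w)"
    using assms by (intro UN_psi_class)
      (simp_all add: deck_op psi_class_deck univ_op_closed deck_closed)
  then show "psi_class x z \<triangleright>\<^bsub>psi_cov Q q X\<^esub> psi_class y w = psi_class x (z \<triangleright>\<^bsub>U\<^esub> w)"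
    by (simp add: psi_cov_def)
  have "(\<Union>(x, z)\<in>psi_class x z. \<Union>(y, w)\<in>psi_class y w. psi_class x (z \<triangleleft>\<^bsub>U\<^esub> w)) =
      psi_class x (z \<triangleleft>\<^bsub>U\<^esub> w)"
    using assms by (intro UN_psi_class)
      (simp_all add: deck_op psi_class_deck univ_op_closed deck_closed)
  then show "psi_class x z \<triangleleft>\<^bsub>psi_cov Q q X\<^esub> psi_class y w = psi_class x (z \<triangleleft>\<^bsub>U\<^esub> w)"
    by (simp add: psi_cov_def)
qed

lemma psi_proj:
  assumes "x \<in> carrier X" "z \<in> carrier U"
  shows "proj (psi_cov Q q X) (psi_class x z) = fst z"
proof -
  have "(\<lambda>(x, z). fst z) ` psi_class x z = {fst z}"
    using psi_class_self[OF assms] by (auto elim!: mem_psi_class simp: deck_def image_iff)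
  then show ?thesis by (simp add: psi_cov_def)
qed

lemma quandle_psi: "quandle (psi_cov Q q X)"
proof -
  interpret U: quandle U by (rule quandle_univ)
  show ?thesis
  proof unfold_locales
    fix A B C assume *: "A \<in> carrier (psi_cov Q q X)" "B \<in> carrier (psi_cov Q q X)"
      "C \<in> carrier (psi_cov Q q X)"
    obtain x u where x: "A = psi_class x u" "x \<in> carrier X" "u \<in> carrier U"
      using *(1) by (rule psi_cases)
    obtain y v where y: "B = psi_class y v" "y \<in> carrier X" "v \<in> carrier U"
      using *(2) by (rule psi_cases)
    obtain z w where z: "C = psi_class z w" "z \<in> carrier X" "w \<in> carrier U"
      using *(3) by (rule psi_cases)
    show "(A \<triangleright>\<^bsub>psi_cov Q q X\<^esub> B) \<triangleright>\<^bsub>psi_cov Q q X\<^esub> C =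
        (A \<triangleright>\<^bsub>psi_cov Q q X\<^esub> C) \<triangleright>\<^bsub>psi_cov Q q X\<^esub> (B \<triangleright>\<^bsub>psi_cov Q q X\<^esub> C)"
      using x y z U.distrib[of u v w] by (simp add: psi_op univ_op_closed)
  qed (auto elim!: psi_cases simp: psi_op univ_op_closed psi_class_closed U.idem U.op_bar U.bar_op)
qed

text \<open>
  All conditions are inherited from the universal covering; surjectivity of the projection also
  takes a point of \<open>X\<close>.
\<close>

lemma is_covering_psi:
  assumes "carrier X \<noteq> {}"
  shows "is_covering Q (psi_cov Q q X)"
  unfolding is_covering_def
proof (intro conjI ballI impI)
  note U = is_coveringD[OF is_covering_univ]
  show "proj (psi_cov Q q X) \<in> quandle_hom (psi_cov Q q X) Q"
    using quandle_hom_closed[OF U(3)] quandle_hom_op[OF U(3)]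
    by (auto simp: quandle_hom_def psi_op psi_proj univ_op_closed elim!: psi_cases)
  show "proj (psi_cov Q q X) ` carrier (psi_cov Q q X) = carrier Q"
  proof
    show "proj (psi_cov Q q X) ` carrier (psi_cov Q q X) \<subseteq> carrier Q"
      using quandle_hom_closed[OF U(3)] by (auto simp: psi_proj elim!: psi_cases)
    show "carrier Q \<subseteq> proj (psi_cov Q q X) ` carrier (psi_cov Q q X)"
    proof
      fix a assume "a \<in> carrier Q"
      then obtain z where z: "z \<in> carrier U" "fst z = a"
        using U(4) by (metis imageE univ_proj)
      obtain x where x: "x \<in> carrier X" using assms by blast
      show "a \<in> proj (psi_cov Q q X) ` carrier (psi_cov Q q X)"
        using psi_proj[OF x z(1)] psi_class_closed[OF x z(1)] z(2) by (intro image_eqI) auto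
    qed
  qed
  fix A B C assume *: "A \<in> carrier (psi_cov Q q X)" "B \<in> carrier (psi_cov Q q X)"
    "C \<in> carrier (psi_cov Q q X)" "proj (psi_cov Q q X) B = proj (psi_cov Q q X) C"
  obtain x u where x: "A = psi_class x u" "x \<in> carrier X" "u \<in> carrier U"
    using *(1) by (rule psi_cases)
  obtain y v where y: "B = psi_class y v" "y \<in> carrier X" "v \<in> carrier U"
    using *(2) by (rule psi_cases)
  obtain z w where z: "C = psi_class z w" "z \<in> carrier X" "w \<in> carrier U"
    using *(3) by (rule psi_cases)
  have "u \<triangleright>\<^bsub>U\<^esub> v = u \<triangleright>\<^bsub>U\<^esub> w"
    using *(4) x y z by (intro U(5)) (simp_all add: psi_proj)
  then show "A \<triangleright>\<^bsub>psi_cov Q q X\<^esub> B = A \<triangleright>\<^bsub>psi_cov Q q X\<^esub> C"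
    using x y z by (simp add: psi_op)
qed (auto simp: quandle_psi quandle_axioms)

text \<open>
  For fixed \<open>x\<close>, the map \<open>z \<mapsto> [x, z]\<close> is a covering morphism, so the monodromy on the
  associated covering can be computed in the universal one, where it is right multiplication.
\<close>

lemma psi_cov_act:
  assumes "x \<in> carrier X" "g \<in> carrier (pi1 Q q)"
  shows "cov_act (psi_cov Q q X) (psi_class x (q, \<one>\<^bsub>Adj Q\<^esub>)) g =
    psi_class (act X x g) (q, \<one>\<^bsub>Adj Q\<^esub>)"
proof -
  let ?f = "\<lambda>z\<in>carrier U. psi_class x z" and ?e = "(q, \<one>\<^bsub>Adj Q\<^esub>)"
  have f: "?f \<in> cov_hom U (psi_cov Q q X)"
    using assms(1) by (auto simp: cov_hom_def quandle_hom_def psi_op psi_proj univ_op_closed psi_class_closed)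
  have "?f (cov_act U ?e g) = cov_act (psi_cov Q q X) (?f ?e) g"
    using assms is_covering_psi
    by (intro cov_hom_equivariant[OF is_covering_univ _ f _ base_point_closed]) auto
  moreover have "cov_act U ?e g = deck Q g ?e"
    using assms(2) univ_cov_act[of g] by (simp add: pi1_iff Adj0_iff deck_def del: Adj0_closed pi1_closed)
  ultimately show ?thesis
    using assms base_point_closed by (simp add: psi_class_deck deck_closed)
qed

end

section \<open>The monodromy action on the fibre\<close>

context pointed_connected_quandle
begin

abbreviation fibre :: "('b, 'a) covering \<Rightarrow> ('b, 'a adj) gset" where
  "fibre P \<equiv> fobj (Phi Q q) P"

lemma fibre_carrier: "carrier (fibre P) = {x \<in> carrier P. proj P x = q}"
  by (simp add: Phi_def)

lemma fibre_act: "act (fibre P) = cov_act P"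
  by (simp add: Phi_def)

lemma right_action_fibre: "is_covering Q P \<Longrightarrow> right_action (pi1 Q q) (fibre P)"
  by (auto simp: right_action_def fibre_carrier fibre_act cov_act_closed cov_act_one cov_act_mult
      proj_cov_act pi1_iff)

lemma fibre_nonempty: "is_covering Q P \<Longrightarrow> carrier (fibre P) \<noteq> {}"
  using covering_section[of Q P q] by (auto simp: fibre_carrier)

lemma Phi_fmap: "x \<in> carrier (fibre P) \<Longrightarrow> fmap (Phi Q q) P R \<phi> x = \<phi> x"
  by (simp add: Phi_def)

text \<open>
  A covering morphism is equivariant for all of \<open>Adj Q\<close>, in particular for the fundamental group.
\<close>

lemma fibre_restrict_hom:
  assumes P: "is_covering Q P" and R: "is_covering Q R" and \<phi>: "\<phi> \<in> cov_hom P R"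
  shows "restrict \<phi> (carrier (fibre P)) \<in> act_hom (pi1 Q q) (fibre P) (fibre R)"
proof -
  have "cov_act P x g \<in> carrier (fibre P)"
    if "x \<in> carrier (fibre P)" "g \<in> carrier (pi1 Q q)" for x g
    using that right_action_fibre[OF P] by (simp add: right_action_def fibre_act)
  then show ?thesis
    using cov_homD[OF \<phi>] cov_hom_equivariant[OF P R \<phi>]
    by (auto simp: act_hom_def fibre_act) (auto simp: fibre_carrier)
qed

end

section \<open>The categories and the functor from coverings to actions\<close>

lemma is_category_Cov: "is_category (Cov Q)"
  unfolding is_category_def Cov_def
  by (auto simp: cov_hom_def quandle_hom_def compose_def extensional_def fun_eq_iff Pi_iff
      quandle.op_closed is_coveringD(1))

lemma is_category_Act: "is_category (Act G)"
  unfolding is_category_def Act_def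
  by (auto simp: act_hom_def right_action_def compose_def fun_eq_iff PiE_iff extensional_def)

context pointed_connected_quandle
begin

lemma is_functor_Phi: "is_functor (Cov Q) (Act (pi1 Q q)) (Phi Q q)"
  unfolding is_functor_def
proof (intro conjI ballI)
  fix P R :: "('b, 'a) covering" and \<phi>
  assume "P \<in> Obj (Cov Q)" "R \<in> Obj (Cov Q)" "\<phi> \<in> Hom (Cov Q) P R"
  then show "fmap (Phi Q q) P R \<phi> \<in> Hom (Act (pi1 Q q)) (fobj (Phi Q q) P) (fobj (Phi Q q) R)"
    using fibre_restrict_hom[of P R \<phi>] by (simp add: Cov_def Act_def Phi_def)
next
  fix P R S :: "('b, 'a) covering" and \<phi> \<psi>
  assume "\<phi> \<in> Hom (Cov Q) P R" "\<psi> \<in> Hom (Cov Q) R S"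
  then show "fmap (Phi Q q) P S (Comp (Cov Q) P R S \<psi> \<phi>) =
      Comp (Act (pi1 Q q)) (fobj (Phi Q q) P) (fobj (Phi Q q) R) (fobj (Phi Q q) S)
        (fmap (Phi Q q) R S \<psi>) (fmap (Phi Q q) P R \<phi>)"
    using cov_homD(3,4)[of \<phi> P R] by (auto simp: Cov_def Act_def Phi_def compose_def fun_eq_iff)
next
  fix P :: "('b, 'a) covering"
  show "fmap (Phi Q q) P P (Ident (Cov Q) P) = Ident (Act (pi1 Q q)) (fobj (Phi Q q) P)"
    by (auto simp: Cov_def Act_def Phi_def fun_eq_iff)
  assume "P \<in> Obj (Cov Q)"
  then show "fobj (Phi Q q) P \<in> Obj (Act (pi1 Q q))"
    using right_action_fibre[of P] fibre_nonempty[of P] by (simp add: Cov_def Act_def)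
qed

end

section \<open>The functor from actions to coverings\<close>

lemma act_homD:
  assumes "\<phi> \<in> act_hom G X Y"
  shows "\<phi> \<in> extensional (carrier X)" "\<And>x. x \<in> carrier X \<Longrightarrow> \<phi> x \<in> carrier Y"
    "\<And>x g. x \<in> carrier X \<Longrightarrow> g \<in> carrier G \<Longrightarrow> \<phi> (act X x g) = act Y (\<phi> x) g"
  using assms by (auto simp: act_hom_def PiE_iff)

context pointed_connected_quandle
begin

lemma Act_objD:
  assumes "X \<in> Obj (Act (pi1 Q q))"
  shows "pi1_set Q q X" "carrier X \<noteq> {}"
  using assms by (auto simp: Act_def pi1_set_def pi1_set_axioms_def pointed_connected_quandle_axioms)

lemma Psi_fmap_class:
  assumes "pi1_set Q q X" "pi1_set Q q Y" and \<phi>: "\<phi> \<in> act_hom (pi1 Q q) X Y"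
    and x: "x \<in> carrier X" and z: "z \<in> carrier U"
  shows "fmap (Psi Q q) X Y \<phi> (psi_rel Q q X `` {(x, z)}) = psi_rel Q q Y `` {(\<phi> x, z)}"
proof -
  interpret X: pi1_set Q q X by fact
  interpret Y: pi1_set Q q Y by fact
  have "(\<Union>(y, w)\<in>X.psi_class x z. Y.psi_class (\<phi> y) w) = Y.psi_class (\<phi> x) z"
    using x z by (intro X.UN_psi_class) (simp_all add: act_homD[OF \<phi>] Y.psi_class_deck)
  then show ?thesis
    using X.psi_class_closed[OF x z] by (simp add: Psi_def)
qed

lemma Psi_fmap_hom:
  assumes "pi1_set Q q X" "pi1_set Q q Y" and \<phi>: "\<phi> \<in> act_hom (pi1 Q q) X Y"
  shows "fmap (Psi Q q) X Y \<phi> \<in> cov_hom (psi_cov Q q X) (psi_cov Q q Y)"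
proof -
  interpret X: pi1_set Q q X by fact
  interpret Y: pi1_set Q q Y by fact
  have "fmap (Psi Q q) X Y \<phi> \<in> extensional (carrier (psi_cov Q q X))"
    by (simp add: Psi_def)
  then show ?thesis
    by (auto simp: cov_hom_def quandle_hom_def X.psi_op Y.psi_op X.psi_proj Y.psi_proj univ_op_closed
        Psi_fmap_class[OF assms] act_homD[OF \<phi>] Y.psi_class_closed elim!: X.psi_cases)
qed

lemma act_hom_compose:
  "\<phi> \<in> act_hom G X Y \<Longrightarrow> \<psi> \<in> act_hom G Y Z \<Longrightarrow> right_action G X \<Longrightarrow>
   compose (carrier X) \<psi> \<phi> \<in> act_hom G X Z"
  by (auto simp: act_hom_def compose_def right_action_def)

lemma is_functor_Psi: "is_functor (Act (pi1 Q q)) (Cov Q) (Psi Q q)"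
  unfolding is_functor_def
proof (intro conjI ballI)
  fix X Y :: "('b, 'a adj) gset" and \<phi>
  assume "X \<in> Obj (Act (pi1 Q q))" "Y \<in> Obj (Act (pi1 Q q))" "\<phi> \<in> Hom (Act (pi1 Q q)) X Y"
  then show "fmap (Psi Q q) X Y \<phi> \<in> Hom (Cov Q) (fobj (Psi Q q) X) (fobj (Psi Q q) Y)"
    using Psi_fmap_hom[OF Act_objD(1) Act_objD(1)] by (simp add: Cov_def Act_def Psi_def)
next
  fix X Y Z :: "('b, 'a adj) gset" and \<phi> \<psi>
  assume *: "X \<in> Obj (Act (pi1 Q q))" "Y \<in> Obj (Act (pi1 Q q))" "Z \<in> Obj (Act (pi1 Q q))"
    "\<phi> \<in> Hom (Act (pi1 Q q)) X Y" "\<psi> \<in> Hom (Act (pi1 Q q)) Y Z"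
  interpret X: pi1_set Q q X by (rule Act_objD[OF *(1)])
  interpret Y: pi1_set Q q Y by (rule Act_objD[OF *(2)])
  interpret Z: pi1_set Q q Z by (rule Act_objD[OF *(3)])
  have \<phi>: "\<phi> \<in> act_hom (pi1 Q q) X Y" and \<psi>: "\<psi> \<in> act_hom (pi1 Q q) Y Z"
    using * by (auto simp: Act_def)
  note \<psi>\<phi> = act_hom_compose[OF \<phi> \<psi> X.right_action]
  have "fmap (Psi Q q) X Z (compose (carrier X) \<psi> \<phi>) =
      compose (carrier (psi_cov Q q X)) (fmap (Psi Q q) Y Z \<psi>) (fmap (Psi Q q) X Y \<phi>)"
  proof (rule extensionalityI)
    show "fmap (Psi Q q) X Z (compose (carrier X) \<psi> \<phi>) \<in> extensional (carrier (psi_cov Q q X))"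
      by (simp add: Psi_def)
    fix A assume A: "A \<in> carrier (psi_cov Q q X)"
    then obtain x z where x: "A = X.psi_class x z" "x \<in> carrier X" "z \<in> carrier U"
      by (rule X.psi_cases)
    then show "fmap (Psi Q q) X Z (compose (carrier X) \<psi> \<phi>) A =
        compose (carrier (psi_cov Q q X)) (fmap (Psi Q q) Y Z \<psi>) (fmap (Psi Q q) X Y \<phi>) A"
      using A Psi_fmap_class[OF X.pi1_set_axioms Z.pi1_set_axioms \<psi>\<phi> x(2,3)]
        Psi_fmap_class[OF X.pi1_set_axioms Y.pi1_set_axioms \<phi> x(2,3)]
        Psi_fmap_class[OF Y.pi1_set_axioms Z.pi1_set_axioms \<psi> act_homD(2)[OF \<phi> x(2)] x(3)]
      by (simp add: compose_eq)
  qed (rule compose_extensional)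
  then show "fmap (Psi Q q) X Z (Comp (Act (pi1 Q q)) X Y Z \<psi> \<phi>) =
      Comp (Cov Q) (fobj (Psi Q q) X) (fobj (Psi Q q) Y) (fobj (Psi Q q) Z)
        (fmap (Psi Q q) Y Z \<psi>) (fmap (Psi Q q) X Y \<phi>)"
    by (simp add: Cov_def Act_def Psi_def)
next
  fix X :: "('b, 'a adj) gset"
  assume *: "X \<in> Obj (Act (pi1 Q q))"
  interpret X: pi1_set Q q X by (rule Act_objD[OF *])
  show "fobj (Psi Q q) X \<in> Obj (Cov Q)"
    using X.is_covering_psi Act_objD(2)[OF *] by (simp add: Cov_def Psi_def)
  have id: "(\<lambda>x\<in>carrier X. x) \<in> act_hom (pi1 Q q) X X"
    by (auto simp: act_hom_def X.act_closed)
  have "fmap (Psi Q q) X X (\<lambda>x\<in>carrier X. x) = (\<lambda>A\<in>carrier (psi_cov Q q X). A)"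
  proof (rule extensionalityI)
    show "fmap (Psi Q q) X X (\<lambda>x\<in>carrier X. x) \<in> extensional (carrier (psi_cov Q q X))"
      by (simp add: Psi_def)
    fix A assume A: "A \<in> carrier (psi_cov Q q X)"
    then obtain x z where x: "A = X.psi_class x z" "x \<in> carrier X" "z \<in> carrier U"
      by (rule X.psi_cases)
    then show "fmap (Psi Q q) X X (\<lambda>x\<in>carrier X. x) A = (\<lambda>A\<in>carrier (psi_cov Q q X). A) A"
      using A Psi_fmap_class[OF X.pi1_set_axioms X.pi1_set_axioms id x(2,3)] by simp
  qed simp
  then show "fmap (Psi Q q) X X (Ident (Act (pi1 Q q)) X) = Ident (Cov Q) (fobj (Psi Q q) X)"
    by (simp add: Cov_def Act_def Psi_def)
qed

end

section \<open>Isomorphisms\<close>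

lemma cov_iso_inverse:
  assumes P: "is_covering Q P" and R: "is_covering Q R" and \<phi>: "\<phi> \<in> cov_hom P R"
    and bij: "bij_betw \<phi> (carrier P) (carrier R)"
  shows "cov_iso P R \<phi>" and "cov_iso R P (restrict (inv_into (carrier P) \<phi>) (carrier R))"
proof -
  let ?\<psi> = "restrict (inv_into (carrier P) \<phi>) (carrier R)"
  interpret P: quandle P by (rule is_coveringD[OF P])
  interpret R: quandle R by (rule is_coveringD[OF R])
  have in_P: "inv_into (carrier P) \<phi> y \<in> carrier P"
    and right: "\<phi> (inv_into (carrier P) \<phi> y) = y" if "y \<in> carrier R" for y
    using that bij_betw_imp_surj_on[OF bij] by (metis inv_into_into, metis f_inv_into_f)
  have left: "inv_into (carrier P) \<phi> (\<phi> x) = x" if "x \<in> carrier P" for x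
    using that bij by (simp add: bij_betw_def)
  have "inv_into (carrier P) \<phi> (x \<triangleright>\<^bsub>R\<^esub> y) =
      inv_into (carrier P) \<phi> x \<triangleright>\<^bsub>P\<^esub> inv_into (carrier P) \<phi> y"
    if "x \<in> carrier R" "y \<in> carrier R" for x y
    using left[OF P.op_closed[OF in_P in_P], OF that] that
    by (simp add: cov_homD(5)[OF \<phi>] in_P right)
  moreover have "proj P (inv_into (carrier P) \<phi> y) = proj R y" if "y \<in> carrier R" for y
    using cov_homD(3)[OF \<phi> in_P[OF that]] that by (simp add: right)
  ultimately have \<psi>: "?\<psi> \<in> cov_hom R P"
    by (auto simp: cov_hom_def quandle_hom_def in_P R.op_closed)
  show "cov_iso P R \<phi>"
    unfolding cov_iso_def using \<phi> \<psi> cov_homD(4)[OF \<phi>]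
    by (intro conjI bexI[of _ ?\<psi>]) (simp_all add: left right)
  show "cov_iso R P ?\<psi>"
    unfolding cov_iso_def using \<phi> \<psi> cov_homD(4)[OF \<phi>]
    by (intro conjI bexI[of _ \<phi>]) (simp_all add: left right)
qed

lemma act_isoI:
  assumes X: "right_action G X" and \<phi>: "\<phi> \<in> act_hom G X Y" and Y: "right_action G Y"
    and bij: "bij_betw \<phi> (carrier X) (carrier Y)"
  shows "act_iso G X Y \<phi>"
proof -
  let ?\<psi> = "restrict (inv_into (carrier X) \<phi>) (carrier Y)"
  have in_X: "inv_into (carrier X) \<phi> y \<in> carrier X"
    and right: "\<phi> (inv_into (carrier X) \<phi> y) = y" if "y \<in> carrier Y" for y
    using that bij_betw_imp_surj_on[OF bij] by (metis inv_into_into, metis f_inv_into_f)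
  have left: "inv_into (carrier X) \<phi> (\<phi> x) = x" if "x \<in> carrier X" for x
    using that bij by (simp add: bij_betw_def)
  have "inv_into (carrier X) \<phi> (act Y y g) = act X (inv_into (carrier X) \<phi> y) g"
    if "y \<in> carrier Y" "g \<in> carrier G" for y g
  proof -
    have "act X (inv_into (carrier X) \<phi> y) g \<in> carrier X"
      using X that in_X by (simp add: right_action_def)
    from left[OF this] show ?thesis
      using \<phi> that by (simp add: act_hom_def in_X right)
  qed
  then have "?\<psi> \<in> act_hom G Y X"
    using Y by (auto simp: act_hom_def right_action_def in_X)
  then show ?thesis
    unfolding act_iso_def using \<phi> act_homD(2)[OF \<phi>]
    by (intro conjI bexI[of _ ?\<psi>]) (simp_all add: left right)
qed

lemma cov_iso_compose:
  assumes "cov_iso P R \<phi>" "cov_iso R S \<psi>" "is_covering Q P" "is_covering Q S"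
  shows "cov_iso P S (compose (carrier P) \<psi> \<phi>)"
proof -
  interpret P: quandle P by (rule is_coveringD[OF assms(3)])
  interpret S: quandle S by (rule is_coveringD[OF assms(4)])
  obtain \<phi>' where \<phi>': "\<phi>' \<in> cov_hom R P" "\<forall>x\<in>carrier P. \<phi>' (\<phi> x) = x"
    "\<forall>y\<in>carrier R. \<phi> (\<phi>' y) = y" using assms(1) by (auto simp: cov_iso_def)
  obtain \<psi>' where \<psi>': "\<psi>' \<in> cov_hom S R" "\<forall>x\<in>carrier R. \<psi>' (\<psi> x) = x"
    "\<forall>y\<in>carrier S. \<psi> (\<psi>' y) = y" using assms(2) by (auto simp: cov_iso_def)
  have "compose (carrier P) \<psi> \<phi> \<in> cov_hom P S" "compose (carrier S) \<phi>' \<psi>' \<in> cov_hom S P"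
    using assms(1,2) \<phi>'(1) \<psi>'(1) P.op_closed S.op_closed
    by (auto simp: cov_iso_def cov_hom_def quandle_hom_def compose_def Pi_iff)
  moreover have "\<phi> x \<in> carrier R" if "x \<in> carrier P" for x
    using assms(1) that unfolding cov_iso_def by (blast intro: cov_homD(4))
  moreover have "\<psi> x \<in> carrier S" if "x \<in> carrier R" for x
    using assms(2) that unfolding cov_iso_def by (blast intro: cov_homD(4))
  moreover have "\<phi>' y \<in> carrier P" if "y \<in> carrier R" for y
    using \<phi>'(1) that by (rule cov_homD(4))
  moreover have "\<psi>' y \<in> carrier R" if "y \<in> carrier S" for y
    using \<psi>'(1) that by (rule cov_homD(4))
  ultimately show ?thesis
    using \<phi>' \<psi>'
    unfolding cov_iso_def
    by (intro conjI bexI[of _ "compose (carrier S) \<phi>' \<psi>'"]) (simp_all add: compose_eq)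
qed

lemma act_iso_compose:
  assumes "act_iso G X Y \<phi>" "act_iso G Y Z \<psi>" "right_action G X" "right_action G Z"
  shows "act_iso G X Z (compose (carrier X) \<psi> \<phi>)"
proof -
  obtain \<phi>' where \<phi>': "\<phi>' \<in> act_hom G Y X" "\<forall>x\<in>carrier X. \<phi>' (\<phi> x) = x"
    "\<forall>y\<in>carrier Y. \<phi> (\<phi>' y) = y" using assms(1) by (auto simp: act_iso_def)
  obtain \<psi>' where \<psi>': "\<psi>' \<in> act_hom G Z Y" "\<forall>x\<in>carrier Y. \<psi>' (\<psi> x) = x"
    "\<forall>y\<in>carrier Z. \<psi> (\<psi>' y) = y" using assms(2) by (auto simp: act_iso_def)
  have "compose (carrier X) \<psi> \<phi> \<in> act_hom G X Z" "compose (carrier Z) \<phi>' \<psi>' \<in> act_hom G Z X"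
    using assms \<phi>'(1) \<psi>'(1)
    by (auto simp: act_iso_def act_hom_def right_action_def compose_def)
  moreover have "\<phi> x \<in> carrier Y" if "x \<in> carrier X" for x
    using assms(1) that unfolding act_iso_def by (blast intro: act_homD(2))
  moreover have "\<psi> x \<in> carrier Z" if "x \<in> carrier Y" for x
    using assms(2) that unfolding act_iso_def by (blast intro: act_homD(2))
  moreover have "\<phi>' y \<in> carrier X" if "y \<in> carrier Y" for y
    using \<phi>'(1) that by (rule act_homD(2))
  moreover have "\<psi>' y \<in> carrier Y" if "y \<in> carrier Z" for y
    using \<psi>'(1) that by (rule act_homD(2))
  ultimately show ?thesis
    using \<phi>' \<psi>'
    unfolding act_iso_def
    by (intro conjI bexI[of _ "compose (carrier Z) \<phi>' \<psi>'"]) (simp_all add: compose_eq)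
qed

lemma cov_iso_is_iso: "cov_iso P R \<phi> \<Longrightarrow> is_iso (Cov Q) P R \<phi>"
  by (fastforce simp: cov_iso_def is_iso_def Cov_def compose_def fun_eq_iff)

lemma act_iso_is_iso: "act_iso G X Y \<phi> \<Longrightarrow> is_iso (Act G) X Y \<phi>"
  by (fastforce simp: act_iso_def is_iso_def Act_def compose_def fun_eq_iff)

section \<open>The two natural isomorphisms\<close>

context pointed_connected_quandle
begin

text \<open>
  The map \<open>[x, (a, g)] \<mapsto> x\<^sup>g\<close>, which carries the fibre over \<open>q\<close> along \<open>g\<close> to the fibre over
  \<open>a = q\<^sup>g\<close>.
\<close>

definition fibre_transport :: "('b, 'a) covering \<Rightarrow> ('b \<times> 'a \<times> 'a adj) set \<Rightarrow> 'b" where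
  "fibre_transport P = (\<lambda>A\<in>carrier (psi_cov Q q (fibre P)).
     the_elem ((\<lambda>(x, z). cov_act P x (snd z)) ` A))"

lemma pi1_set_fibre: "is_covering Q P \<Longrightarrow> pi1_set Q q (fibre P)"
  by unfold_locales (rule right_action_fibre)

context
  fixes P :: "('b, 'a) covering"
  assumes P: "is_covering Q P"
begin

interpretation F: pi1_set Q q "fibre P"
  by (rule pi1_set_fibre[OF P])

lemma in_fibreD:
  assumes "x \<in> carrier (fibre P)"
  shows "x \<in> carrier P" "proj P x = q"
  using assms by (auto simp: fibre_carrier)

text \<open>
  The value is independent of the representative: \<open>[x\<^sup>k, (a, g)]\<close> and \<open>[x, (a, k g)]\<close> are
  both sent to \<open>x\<^bsup>k g\<^esup>\<close>.
\<close>

lemma fibre_transport_class: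
  assumes "x \<in> carrier (fibre P)" "z \<in> carrier U"
  shows "fibre_transport P (F.psi_class x z) = cov_act P x (snd z)"
proof -
  have eq: "cov_act P y (snd w) = cov_act P x (snd z)" if "(y, w) \<in> F.psi_class x z" for y w
    using that
  proof (rule F.mem_psi_class)
    fix g assume g: "g \<in> carrier (pi1 Q q)" "x = act (fibre P) y g" "w = deck Q g z"
      "y \<in> carrier (fibre P)"
    have "snd z \<in> carrier (Adj Q)" using assms(2) by (auto elim: univ_cases)
    then show ?thesis
      using g in_fibreD(1) by (simp add: deck_def fibre_act cov_act_mult[OF P])
  qed
  have "(\<lambda>(x, z). cov_act P x (snd z)) ` F.psi_class x z =
      (\<lambda>_. cov_act P x (snd z)) ` F.psi_class x z"
  proof (rule image_cong[OF HOL.refl])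
    fix t assume "t \<in> F.psi_class x z"
    then show "(case t of (x, z) \<Rightarrow> cov_act P x (snd z)) = cov_act P x (snd z)"
      using eq[of "fst t" "snd t"] by (simp add: case_prod_beta)
  qed
  also have "\<dots> = {cov_act P x (snd z)}"
    by (rule image_constant[OF F.psi_class_self[OF assms]])
  finally have "(\<lambda>(x, z). cov_act P x (snd z)) ` F.psi_class x z = {cov_act P x (snd z)}" .
  then show ?thesis
    using F.psi_class_closed[OF assms] by (simp add: fibre_transport_def)
qed

text \<open>
  The product of \<open>[x, (a, g)]\<close> and \<open>[y, (b, h)]\<close> is sent to \<open>((x\<^sup>g)\<^bsup>inv (adj a)\<^esup>)\<^bsup>adj b\<^esup>\<close>. As \<open>x\<^sup>g\<close>
  lies over \<open>a\<close>, it is idempotent and hence fixed by \<open>adj a\<close>; as \<open>y\<^sup>h\<close> lies over \<open>b\<close>, the last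
  factor is translation by \<open>y\<^sup>h\<close>.
\<close>

lemma fibre_transport_hom: "fibre_transport P \<in> cov_hom (psi_cov Q q (fibre P)) P"
  unfolding cov_hom_def quandle_hom_def
proof (intro CollectI IntI conjI ballI Pi_I)
  interpret P: quandle P by (rule is_coveringD[OF P])
  show "fibre_transport P \<in> extensional (carrier (psi_cov Q q (fibre P)))"
    by (simp add: fibre_transport_def)
  fix A assume "A \<in> carrier (psi_cov Q q (fibre P))"
  then obtain x z where x: "A = F.psi_class x z" "x \<in> carrier (fibre P)" "z \<in> carrier U"
    by (rule F.psi_cases)
  obtain g where g: "z = (quandle_act Q q g, g)" "g \<in> Adj0 Q" "g \<in> carrier (Adj Q)"
    using x(3) by (rule univ_cases)
  have TA: "fibre_transport P A = cov_act P x g"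
    using fibre_transport_class[OF x(2,3)] x(1) g(1) by simp
  have xg: "cov_act P x g \<in> carrier P" "proj P (cov_act P x g) = quandle_act Q q g"
    using cov_act_closed[OF P g(3)] proj_cov_act[OF P g(3)] in_fibreD[OF x(2)] by auto
  show "fibre_transport P A \<in> carrier P"
    by (simp add: TA xg)
  show "proj P (fibre_transport P A) = proj (psi_cov Q q (fibre P)) A"
    unfolding TA xg(2) unfolding x(1) F.psi_proj[OF x(2,3)] by (simp add: g(1))
  fix B assume "B \<in> carrier (psi_cov Q q (fibre P))"
  then obtain y w where y: "B = F.psi_class y w" "y \<in> carrier (fibre P)" "w \<in> carrier U"
    by (rule F.psi_cases)
  obtain h where h: "w = (quandle_act Q q h, h)" "h \<in> Adj0 Q" "h \<in> carrier (Adj Q)"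
    using y(3) by (rule univ_cases)
  have TB: "fibre_transport P B = cov_act P y h"
    using fibre_transport_class[OF y(2,3)] y(1) h(1) by simp
  have yh: "cov_act P y h \<in> carrier P" "proj P (cov_act P y h) = quandle_act Q q h"
    using cov_act_closed[OF P h(3)] proj_cov_act[OF P h(3)] in_fibreD[OF y(2)] by auto
  have "fibre_transport P (A \<triangleright>\<^bsub>psi_cov Q q (fibre P)\<^esub> B) = cov_act P x (snd (z \<triangleright>\<^bsub>U\<^esub> w))"
    using x y by (simp add: F.psi_op fibre_transport_class univ_op_closed)
  also have "\<dots> = cov_act P x (g \<cdot> (adj_gen (quandle_act Q q g))\<^sup>\<inverse> \<cdot> adj_gen (quandle_act Q q h))"
    by (simp add: g(1) h(1) univ_op)
  also have "\<dots> = cov_act P (cov_act P (cov_act P x g) ((adj_gen (quandle_act Q q g))\<^sup>\<inverse>))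
      (adj_gen (quandle_act Q q h))"
    using g h in_fibreD[OF x(2)] by (simp add: cov_act_mult[OF P])
  also have "cov_act P (cov_act P x g) ((adj_gen (quandle_act Q q g))\<^sup>\<inverse>) = cov_act P x g"
    using cov_act_inv_adj[OF P xg(1) xg] P.idem_bar[OF xg(1)] by simp
  also have "cov_act P (cov_act P x g) (adj_gen (quandle_act Q q h)) =
      fibre_transport P A \<triangleright>\<^bsub>P\<^esub> fibre_transport P B"
    using cov_act_adj[OF P xg(1) yh] by (simp add: TA TB)
  finally show "fibre_transport P (A \<triangleright>\<^bsub>psi_cov Q q (fibre P)\<^esub> B) =
      fibre_transport P A \<triangleright>\<^bsub>P\<^esub> fibre_transport P B" .
qed

text \<open>
  If \<open>x\<^sup>g = y\<^sup>h\<close> then \<open>q\<^sup>g = q\<^sup>h\<close>, so \<open>h g\<^sup>\<inverse>\<close> lies in the fundamental group and relates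
  the two representatives.
\<close>

lemma fibre_transport_inj: "inj_on (fibre_transport P) (carrier (psi_cov Q q (fibre P)))"
proof (rule inj_onI)
  fix A B assume "A \<in> carrier (psi_cov Q q (fibre P))" "B \<in> carrier (psi_cov Q q (fibre P))"
    and eq: "fibre_transport P A = fibre_transport P B"
  obtain x z where x: "A = F.psi_class x z" "x \<in> carrier (fibre P)" "z \<in> carrier U"
    using \<open>A \<in> _\<close> by (rule F.psi_cases)
  obtain y w where y: "B = F.psi_class y w" "y \<in> carrier (fibre P)" "w \<in> carrier U"
    using \<open>B \<in> _\<close> by (rule F.psi_cases)
  obtain g where g: "z = (quandle_act Q q g, g)" "g \<in> Adj0 Q" "g \<in> carrier (Adj Q)"
    using x(3) by (rule univ_cases)
  obtain h where h: "w = (quandle_act Q q h, h)" "h \<in> Adj0 Q" "h \<in> carrier (Adj Q)"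
    using y(3) by (rule univ_cases)
  note x' = in_fibreD[OF x(2)] and y' = in_fibreD[OF y(2)]
  have xy: "cov_act P x g = cov_act P y h"
    using eq fibre_transport_class x y g h by simp
  then have qq: "quandle_act Q q g = quandle_act Q q h"
    using proj_cov_act[OF P g(3) x'(1)] proj_cov_act[OF P h(3) y'(1)] x'(2) y'(2) by simp
  let ?k = "h \<cdot> g\<^sup>\<inverse>"
  have k: "?k \<in> carrier (pi1 Q q)"
    using g h by (simp add: pi1_iff flip: qq)
  have "x = act (fibre P) y ?k"
    using g h x' y' cov_act_mult_inv(1)[OF P g(3) x'(1)]
    by (simp add: fibre_act cov_act_mult[OF P] flip: xy)
  moreover have "w = deck Q ?k z"
    using g h qq by (simp add: deck_def Adj.m_assoc)
  ultimately show "A = B"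
    using x y k F.psi_class_eq_iff by blast
qed

text \<open>
  By connectedness, some \<open>g\<close> of degree zero sends \<open>q\<close> to the projection of \<open>y\<close>, and
  moving \<open>y\<close> back along \<open>g\<close> ends in the fibre over \<open>q\<close>.
\<close>

lemma fibre_transport_surj: "fibre_transport P ` carrier (psi_cov Q q (fibre P)) = carrier P"
proof
  show "fibre_transport P ` carrier (psi_cov Q q (fibre P)) \<subseteq> carrier P"
    using cov_homD(4)[OF fibre_transport_hom] by blast
  show "carrier P \<subseteq> fibre_transport P ` carrier (psi_cov Q q (fibre P))"
  proof
    fix y assume y: "y \<in> carrier P"
    obtain g where g: "g \<in> Adj0 Q" "quandle_act Q q g = proj P y"
      using Adj0_transitive covering_proj_closed[OF P y] by blast
    let ?x = "cov_act P y (g\<^sup>\<inverse>)"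
    have x: "?x \<in> carrier (fibre P)"
      using g y quandle_act_mult_inv(1)[of g q]
      by (simp add: fibre_carrier cov_act_closed[OF P] proj_cov_act[OF P])
    have z: "(proj P y, g) \<in> carrier U"
      using g by (simp add: univ_carrier)
    show "y \<in> fibre_transport P ` carrier (psi_cov Q q (fibre P))"
      using fibre_transport_class[OF x z] F.psi_class_closed[OF x z] cov_act_mult_inv(2)[OF P _ y, of g] g
      by (intro image_eqI[of _ _ "F.psi_class ?x (proj P y, g)"]) auto
  qed
qed

lemma fibre_transport_bij:
  "bij_betw (fibre_transport P) (carrier (psi_cov Q q (fibre P))) (carrier P)"
  by (simp add: bij_betw_def fibre_transport_inj fibre_transport_surj)

end

text \<open>
  Both sides send \<open>[x, (a, g)]\<close> to \<open>\<phi> (x\<^sup>g) = (\<phi> x)\<^sup>g\<close>.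
\<close>

lemma fibre_transport_natural:
  assumes P: "is_covering Q P" and R: "is_covering Q R" and \<phi>: "\<phi> \<in> cov_hom P R"
    and A: "A \<in> carrier (psi_cov Q q (fibre P))"
  shows "fibre_transport R (fmap (Psi Q q) (fibre P) (fibre R) (fmap (Phi Q q) P R \<phi>) A) =
    \<phi> (fibre_transport P A)"
proof -
  interpret F: pi1_set Q q "fibre P" by (rule pi1_set_fibre[OF P])
  note f = fibre_restrict_hom[OF P R \<phi>]
  have Phi: "fmap (Phi Q q) P R \<phi> = restrict \<phi> (carrier (fibre P))"
    by (simp add: Phi_def)
  obtain x z where x: "A = F.psi_class x z" "x \<in> carrier (fibre P)" "z \<in> carrier U"
    using A by (rule F.psi_cases)
  have "snd z \<in> carrier (Adj Q)" using x(3) by (auto elim: univ_cases)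
  then show ?thesis
    using x(2,3) act_homD(2)[OF f x(2)] in_fibreD[OF P x(2)]
    by (simp add: x(1) Phi Psi_fmap_class[OF F.pi1_set_axioms pi1_set_fibre[OF R] f]
        fibre_transport_class[OF P] fibre_transport_class[OF R] cov_hom_equivariant[OF P R \<phi>])
qed

text \<open>
  The inverse of transport. Unlike transport it would need a choice of \<open>g\<close> for each point, so its
  properties are obtained by inverting those of transport.
\<close>

definition cov_unit :: "('b, 'a) covering \<Rightarrow> 'b \<Rightarrow> ('b \<times> 'a \<times> 'a adj) set" where
  "cov_unit P = restrict (inv_into (carrier (psi_cov Q q (fibre P))) (fibre_transport P)) (carrier P)"

lemma cov_iso_unit:
  assumes "is_covering Q P"
  shows "cov_iso P (psi_cov Q q (fibre P)) (cov_unit P)"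
  unfolding cov_unit_def
  using pi1_set.is_covering_psi[OF pi1_set_fibre[OF assms] fibre_nonempty[OF assms]] assms
  by (intro cov_iso_inverse(2) fibre_transport_hom fibre_transport_bij)

lemma cov_unit_natural:
  assumes P: "is_covering Q P" and R: "is_covering Q R" and \<phi>: "\<phi> \<in> cov_hom P R"
    and x: "x \<in> carrier P"
  shows "cov_unit R (\<phi> x) =
    fmap (Psi Q q) (fibre P) (fibre R) (fmap (Phi Q q) P R \<phi>) (cov_unit P x)"
    (is "_ = ?B")
proof -
  have "x \<in> fibre_transport P ` carrier (psi_cov Q q (fibre P))"
    using fibre_transport_surj[OF P] x by simp
  then have A: "cov_unit P x \<in> carrier (psi_cov Q q (fibre P))" "fibre_transport P (cov_unit P x) = x"
    unfolding cov_unit_def using x by (simp_all add: inv_into_into f_inv_into_f)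
  have "fmap (Phi Q q) P R \<phi> \<in> act_hom (pi1 Q q) (fibre P) (fibre R)"
    using fibre_restrict_hom[OF P R \<phi>] by (simp add: Phi_def)
  then have "?B \<in> carrier (psi_cov Q q (fibre R))"
    using A(1) by (intro cov_homD(4)[OF Psi_fmap_hom[OF pi1_set_fibre[OF P] pi1_set_fibre[OF R]]])
  moreover have "fibre_transport R ?B = \<phi> x"
    using fibre_transport_natural[OF P R \<phi> A(1)] A(2) by simp
  ultimately have "inv_into (carrier (psi_cov Q q (fibre R))) (fibre_transport R) (\<phi> x) = ?B"
    using fibre_transport_inj[OF R] by (intro inv_into_f_eq)
  then show ?thesis
    using cov_homD(4)[OF \<phi> x] by (simp add: cov_unit_def)
qed

definition act_unit :: "('x, 'a adj) gset \<Rightarrow> 'x \<Rightarrow> ('x \<times> 'a \<times> 'a adj) set" where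
  "act_unit X = (\<lambda>x\<in>carrier X. psi_rel Q q X `` {(x, (q, \<one>\<^bsub>Adj Q\<^esub>))})"

text \<open>
  Equivariance is \<open>psi_cov_act\<close>. For injectivity, only the neutral element of the fundamental group
  fixes \<open>(q, 1)\<close>. For surjectivity, a class over \<open>q\<close> has the form \<open>[x, (q, g)]\<close> with \<open>g\<close> in the
  fundamental group, and this is \<open>[x\<^sup>g, (q, 1)]\<close>.
\<close>

lemma act_iso_unit:
  assumes "pi1_set Q q X" "carrier X \<noteq> {}"
  shows "act_iso (pi1 Q q) X (fibre (psi_cov Q q X)) (act_unit X)"
proof -
  interpret X: pi1_set Q q X by fact
  let ?e = "(q, \<one>\<^bsub>Adj Q\<^esub>)"
  have P: "is_covering Q (psi_cov Q q X)"
    by (rule X.is_covering_psi[OF assms(2)])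
  have closed: "X.psi_class x ?e \<in> carrier (fibre (psi_cov Q q X))" if "x \<in> carrier X" for x
    using that by (simp add: fibre_carrier X.psi_class_closed X.psi_proj base_point_closed)
  show ?thesis
  proof (rule act_isoI[OF X.right_action _ right_action_fibre[OF P]])
    show "act_unit X \<in> act_hom (pi1 Q q) X (fibre (psi_cov Q q X))"
      by (auto simp: act_unit_def act_hom_def closed X.act_closed fibre_act X.psi_cov_act)
    show "bij_betw (act_unit X) (carrier X) (carrier (fibre (psi_cov Q q X)))"
      unfolding bij_betw_def
    proof
      show "inj_on (act_unit X) (carrier X)"
      proof (rule inj_onI)
        fix x y assume xy: "x \<in> carrier X" "y \<in> carrier X" "act_unit X x = act_unit X y"
        then obtain g where "g \<in> carrier (pi1 Q q)" "x = act X y g" "?e = deck Q g ?e"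
          using X.psi_class_eq_iff[OF xy(1) base_point_closed xy(2) base_point_closed]
          by (auto simp: act_unit_def)
        then show "x = y"
          using X.act_one[OF xy(2)] by (simp add: deck_def)
      qed
      show "act_unit X ` carrier X = carrier (fibre (psi_cov Q q X))"
      proof
        show "act_unit X ` carrier X \<subseteq> carrier (fibre (psi_cov Q q X))"
          by (auto simp: act_unit_def closed)
        show "carrier (fibre (psi_cov Q q X)) \<subseteq> act_unit X ` carrier X"
        proof
          fix A assume "A \<in> carrier (fibre (psi_cov Q q X))"
          then have A: "A \<in> carrier (psi_cov Q q X)" "proj (psi_cov Q q X) A = q"
            by (simp_all add: fibre_carrier)
          obtain x z where x: "A = X.psi_class x z" "x \<in> carrier X" "z \<in> carrier U"
            using A(1) by (rule X.psi_cases)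
          obtain g where g: "z = (quandle_act Q q g, g)" "g \<in> Adj0 Q" "g \<in> carrier (Adj Q)"
            using x(3) by (rule univ_cases)
          have "g \<in> carrier (pi1 Q q)" "z = deck Q g ?e"
            using A x g by (auto simp: X.psi_proj pi1_iff deck_def)
          then have "A = act_unit X (act X x g)" "act X x g \<in> carrier X"
            using x X.psi_class_deck[OF x(2) base_point_closed]
            by (simp_all add: act_unit_def X.act_closed)
          then show "A \<in> act_unit X ` carrier X" by blast
        qed
      qed
    qed
  qed
qed

lemma act_unit_natural:
  assumes X: "pi1_set Q q X" "carrier X \<noteq> {}" and Y: "pi1_set Q q Y"
    and \<phi>: "\<phi> \<in> act_hom (pi1 Q q) X Y" and x: "x \<in> carrier X"
  shows "act_unit Y (\<phi> x) =
    fmap (Phi Q q) (psi_cov Q q X) (psi_cov Q q Y) (fmap (Psi Q q) X Y \<phi>) (act_unit X x)"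
proof -
  have "act_unit X x \<in> carrier (fibre (psi_cov Q q X))"
    using act_iso_unit[OF X] x unfolding act_iso_def by (blast intro: act_homD(2))
  then show ?thesis
    using x act_homD(2)[OF \<phi> x] Psi_fmap_class[OF X(1) Y \<phi> x base_point_closed]
    by (simp add: Phi_fmap) (simp add: act_unit_def)
qed

end

section \<open>Change of universe\<close>

lemma relabel_simps:
  assumes "inj_on j (carrier P)"
  shows "carrier (fobj (relabel j) P) = j ` carrier P"
    and "x \<in> carrier P \<Longrightarrow> y \<in> carrier P \<Longrightarrow>
      qop (fobj (relabel j) P) (j x) (j y) = j (x \<triangleright>\<^bsub>P\<^esub> y)"
    and "x \<in> carrier P \<Longrightarrow> y \<in> carrier P \<Longrightarrow>
      qbar (fobj (relabel j) P) (j x) (j y) = j (x \<triangleleft>\<^bsub>P\<^esub> y)"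
    and "x \<in> carrier P \<Longrightarrow> proj (fobj (relabel j) P) (j x) = proj P x"
    and "x \<in> carrier P \<Longrightarrow> fmap (relabel j) P R \<phi> (j x) = j (\<phi> x)"
  using assms by (simp_all add: relabel_def Let_def)

text \<open>
  Transport of structure along the bijection from the carrier of \<open>P\<close> to its image under \<open>j\<close>.
\<close>

lemma is_covering_relabel:
  assumes P: "is_covering Q P" and inj: "inj_on j (carrier P)"
  shows "is_covering Q (fobj (relabel j) P)"
proof -
  interpret P: quandle P by (rule is_coveringD[OF P])
  note rs = relabel_simps[OF inj]
  have "quandle (fobj (relabel j) P)"
  proof unfold_locales
    fix x y z assume "x \<in> carrier (fobj (relabel j) P)" "y \<in> carrier (fobj (relabel j) P)"
      "z \<in> carrier (fobj (relabel j) P)"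
    then obtain a b c where abc: "x = j a" "y = j b" "z = j c"
      "a \<in> carrier P" "b \<in> carrier P" "c \<in> carrier P" by (auto simp: rs)
    show "qop (fobj (relabel j) P) (qop (fobj (relabel j) P) x y) z =
        qop (fobj (relabel j) P) (qop (fobj (relabel j) P) x z) (qop (fobj (relabel j) P) y z)"
      using abc P.distrib[of a b c] by (simp add: rs P.op_closed)
  qed (auto simp: rs P.op_closed P.bar_closed P.idem P.op_bar P.bar_op)
  moreover have "proj (fobj (relabel j) P) \<in> quandle_hom (fobj (relabel j) P) Q"
    using quandle_hom_closed[OF is_coveringD(3)[OF P]] quandle_hom_op[OF is_coveringD(3)[OF P]]
    by (auto simp: quandle_hom_def rs P.op_closed)
  moreover have "proj (fobj (relabel j) P) ` carrier (fobj (relabel j) P) = carrier Q"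
    unfolding is_coveringD(4)[OF P, symmetric] rs(1) image_image
    by (intro image_cong) (simp_all add: rs)
  moreover have "qop (fobj (relabel j) P) x y = qop (fobj (relabel j) P) x z"
    if xyz: "x \<in> carrier (fobj (relabel j) P)" "y \<in> carrier (fobj (relabel j) P)"
      "z \<in> carrier (fobj (relabel j) P)"
      "proj (fobj (relabel j) P) y = proj (fobj (relabel j) P) z" for x y z
  proof -
    obtain a b c where abc: "x = j a" "y = j b" "z = j c"
      "a \<in> carrier P" "b \<in> carrier P" "c \<in> carrier P" using xyz by (auto simp: rs)
    then have "a \<triangleright>\<^bsub>P\<^esub> b = a \<triangleright>\<^bsub>P\<^esub> c"
      using xyz(4) by (intro is_coveringD(5)[OF P]) (simp_all add: rs)
    then show ?thesis using abc by (simp add: rs)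
  qed
  ultimately show ?thesis
    unfolding is_covering_def using is_coveringD(2)[OF P] by blast
qed

lemma cov_iso_relabel:
  assumes P: "is_covering Q P" and inj: "inj_on j (carrier P)"
  shows "cov_iso P (fobj (relabel j) P) (restrict j (carrier P))"
proof (rule cov_iso_inverse(1)[OF P is_covering_relabel[OF P inj]])
  interpret P: quandle P by (rule is_coveringD[OF P])
  show "restrict j (carrier P) \<in> cov_hom P (fobj (relabel j) P)"
    by (auto simp: cov_hom_def quandle_hom_def relabel_simps[OF inj] P.op_closed)
  show "bij_betw (restrict j (carrier P)) (carrier P) (carrier (fobj (relabel j) P))"
    using inj by (simp add: bij_betw_def relabel_simps inj_on_restrict_eq)
qed

lemma is_functor_relabel:
  assumes F: "is_functor C (Cov Q) F"
    and inj: "\<And>X. X \<in> Obj C \<Longrightarrow> inj_on j (carrier (fobj F X))"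
  shows "is_functor C (Cov Q) (comp_functor (relabel j) F)"
  unfolding is_functor_def
proof (intro conjI ballI)
  fix X assume X: "X \<in> Obj C"
  then have P: "is_covering Q (fobj F X)"
    using F by (simp add: is_functor_def Cov_def)
  show "fobj (comp_functor (relabel j) F) X \<in> Obj (Cov Q)"
    using is_covering_relabel[OF P inj[OF X]] by (simp add: comp_functor_def Cov_def)
  have "fmap F X X (Ident C X) = (\<lambda>x\<in>carrier (fobj F X). x)"
    using F X by (simp add: is_functor_def Cov_def)
  then show "fmap (comp_functor (relabel j) F) X X (Ident C X) =
      Ident (Cov Q) (fobj (comp_functor (relabel j) F) X)"
    using inj[OF X] by (auto simp: comp_functor_def Cov_def relabel_def Let_def fun_eq_iff)
  fix Y assume Y: "Y \<in> Obj C"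
  then have R: "is_covering Q (fobj F Y)"
    using F by (simp add: is_functor_def Cov_def)
  fix f assume f: "f \<in> Hom C X Y"
  then have Ff: "fmap F X Y f \<in> cov_hom (fobj F X) (fobj F Y)"
    using F X Y by (simp add: is_functor_def Cov_def)
  interpret P: quandle "fobj F X" by (rule is_coveringD[OF P])
  have "fmap (relabel j) (fobj F X) (fobj F Y) (fmap F X Y f) \<in>
      extensional (carrier (fobj (relabel j) (fobj F X)))"
    by (simp add: relabel_def Let_def)
  then show "fmap (comp_functor (relabel j) F) X Y f \<in>
      Hom (Cov Q) (fobj (comp_functor (relabel j) F) X) (fobj (comp_functor (relabel j) F) Y)"
    by (auto simp: comp_functor_def Cov_def cov_hom_def quandle_hom_def relabel_simps[OF inj[OF X]]
        relabel_simps[OF inj[OF Y]] P.op_closed cov_homD[OF Ff])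
  fix Z g assume Z: "Z \<in> Obj C" and g: "g \<in> Hom C Y Z"
  have "fmap F X Z (Comp C X Y Z g f) = compose (carrier (fobj F X)) (fmap F Y Z g) (fmap F X Y f)"
    using F X Y Z f g by (simp add: is_functor_def Cov_def)
  then show "fmap (comp_functor (relabel j) F) X Z (Comp C X Y Z g f) =
      Comp (Cov Q) (fobj (comp_functor (relabel j) F) X) (fobj (comp_functor (relabel j) F) Y)
        (fobj (comp_functor (relabel j) F) Z)
        (fmap (comp_functor (relabel j) F) Y Z g) (fmap (comp_functor (relabel j) F) X Y f)"
    using inj[OF X] inj[OF Y] cov_homD(4)[OF Ff]
    by (auto simp: comp_functor_def Cov_def relabel_def Let_def fun_eq_iff compose_def)
qed

text \<open>
  Equal codes come from a common representative, and classes with a common representative are equal.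
\<close>

lemma (in pi1_set) inj_on_class_code:
  assumes "inj_on \<iota> (UNIV \<times> carrier U)"
  shows "inj_on (class_code \<iota>) (carrier (psi_cov Q q X))"
proof (rule inj_onI)
  have some: "(SOME t. t \<in> A) \<in> A \<and> A \<subseteq> UNIV \<times> carrier U"
    if "A \<in> carrier (psi_cov Q q X)" for A
  proof -
    obtain x z where x: "A = psi_class x z" "x \<in> carrier X" "z \<in> carrier U"
      using \<open>A \<in> _\<close> by (rule psi_cases)
    have "(x, z) \<in> A" using x psi_class_self by simp
    then have "(SOME t. t \<in> A) \<in> A" by (rule someI)
    moreover have "A \<subseteq> UNIV \<times> carrier U"
    proof
      fix t assume "t \<in> A"
      then have "(fst t, snd t) \<in> psi_class x z" by (simp add: x(1))
      then have "snd t \<in> carrier U" by (rule mem_psi_class)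
      then show "t \<in> UNIV \<times> carrier U" by (simp add: mem_Times_iff)
    qed
    ultimately show ?thesis ..
  qed
  fix A B assume AB: "A \<in> carrier (psi_cov Q q X)" "B \<in> carrier (psi_cov Q q X)"
    and "class_code \<iota> A = class_code \<iota> B"
  then have "(SOME t. t \<in> A) = (SOME t. t \<in> B)"
    using some[OF AB(1)] some[OF AB(2)] inj_onD[OF assms] unfolding class_code_def by blast
  then have "A \<inter> B \<noteq> {}"
    using some[OF AB(1)] some[OF AB(2)] by auto
  then show "A = B"
    using quotient_disj[OF equiv_psi_rel] AB by (auto simp: psi_cov_def)
qed

context pointed_connected_quandle
begin

text \<open>
  The components are the isomorphisms of coverings \<open>P \<rightarrow> \<Psi> (\<Phi> P)\<close>, followed by the coding of
  classes.
\<close>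

lemma natural_iso_cov:
  fixes \<iota> :: "'u \<times> 'a \<times> 'a adj \<Rightarrow> 'u"
  assumes \<iota>: "inj_on \<iota> (UNIV \<times> carrier U)"
  shows "natural_iso (Cov Q) (Cov Q) id_functor (comp_functor (Psi_in \<iota> Q q) (Phi Q q))
    (\<lambda>P. compose (carrier P) (restrict (class_code \<iota>) (carrier (psi_cov Q q (fibre P)))) (cov_unit P))"
  unfolding natural_iso_def
proof (intro conjI ballI)
  let ?j = "class_code \<iota>"
  let ?\<eta> = "\<lambda>P. compose (carrier P) (restrict ?j (carrier (psi_cov Q q (fibre P)))) (cov_unit P)"
  let ?GF = "comp_functor (Psi_in \<iota> Q q) (Phi Q q)"
  have GF: "fobj ?GF P = fobj (relabel ?j) (psi_cov Q q (fibre P))" for P :: "('u, 'a) covering"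
    by (simp add: comp_functor_def Psi_in_def Psi_def)
  fix P :: "('u, 'a) covering" assume "P \<in> Obj (Cov Q)"
  then have P: "is_covering Q P" by (simp add: Cov_def)
  note FP = pi1_set_fibre[OF P]
  note cov = pi1_set.is_covering_psi[OF FP fibre_nonempty[OF P]]
  note inj = pi1_set.inj_on_class_code[OF FP \<iota>]
  have "cov_iso P (fobj ?GF P) (?\<eta> P)"
    unfolding GF
    by (rule cov_iso_compose[OF cov_iso_unit[OF P] cov_iso_relabel[OF cov inj] P
          is_covering_relabel[OF cov inj]])
  then show "is_iso (Cov Q) (fobj id_functor P) (fobj ?GF P) (?\<eta> P)"
    by (simp add: id_functor_def cov_iso_is_iso)
  fix R \<phi> assume "R \<in> Obj (Cov Q)" "\<phi> \<in> Hom (Cov Q) P R"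
  then have R: "is_covering Q R" and \<phi>: "\<phi> \<in> cov_hom P R" by (simp_all add: Cov_def)
  have unit: "cov_unit S x \<in> carrier (psi_cov Q q (fibre S))"
    if "is_covering Q S" "x \<in> carrier S" for S :: "('u, 'a) covering" and x
    using cov_iso_unit[OF that(1)] that(2) unfolding cov_iso_def by (blast intro: cov_homD(4))
  have "compose (carrier P) (?\<eta> R) \<phi> = compose (carrier P) (fmap ?GF P R \<phi>) (?\<eta> P)"
  proof (rule extensionalityI[OF compose_extensional compose_extensional])
    fix x assume x: "x \<in> carrier P"
    have "fmap ?GF P R \<phi> (?j (cov_unit P x)) =
        ?j (fmap (Psi Q q) (fibre P) (fibre R) (fmap (Phi Q q) P R \<phi>) (cov_unit P x))"
      using relabel_simps(5)[OF inj unit[OF P x]]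
      by (simp add: comp_functor_def Psi_in_def) (simp add: Psi_def)
    then show "compose (carrier P) (?\<eta> R) \<phi> x = compose (carrier P) (fmap ?GF P R \<phi>) (?\<eta> P) x"
      using x cov_homD(4)[OF \<phi> x] unit[OF P x] unit[OF R cov_homD(4)[OF \<phi> x]]
        cov_unit_natural[OF P R \<phi> x] by (simp add: compose_eq)
  qed
  then show "Comp (Cov Q) (fobj id_functor P) (fobj id_functor R) (fobj ?GF R) (?\<eta> R)
        (fmap id_functor P R \<phi>) =
      Comp (Cov Q) (fobj id_functor P) (fobj ?GF P) (fobj ?GF R) (fmap ?GF P R \<phi>) (?\<eta> P)"
    by (simp add: id_functor_def Cov_def)
qed

lemma act_iso_Phi:
  assumes P: "is_covering Q P" and R: "is_covering Q R" and \<phi>: "cov_iso P R \<phi>"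
  shows "act_iso (pi1 Q q) (fibre P) (fibre R) (restrict \<phi> (carrier (fibre P)))"
proof -
  obtain \<psi> where \<psi>: "\<phi> \<in> cov_hom P R" "\<psi> \<in> cov_hom R P" "\<forall>x\<in>carrier P. \<psi> (\<phi> x) = x"
    "\<forall>y\<in>carrier R. \<phi> (\<psi> y) = y" using \<phi> by (auto simp: cov_iso_def)
  show ?thesis
    unfolding act_iso_def
  proof (intro conjI bexI[of _ "restrict \<psi> (carrier (fibre R))"])
    show "\<forall>x\<in>carrier (fibre P). restrict \<psi> (carrier (fibre R)) (restrict \<phi> (carrier (fibre P)) x) = x"
      using \<psi> by (auto simp: fibre_carrier cov_homD)
    show "\<forall>y\<in>carrier (fibre R). restrict \<phi> (carrier (fibre P)) (restrict \<psi> (carrier (fibre R)) y) = y"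
      using \<psi> by (auto simp: fibre_carrier cov_homD)
  qed (use fibre_restrict_hom[OF P R \<psi>(1)] fibre_restrict_hom[OF R P \<psi>(2)] in auto)
qed

text \<open>
  The components are the equivariant bijections from \<open>X\<close> to the fibre of \<open>\<Psi> X\<close>, followed
  by the coding of classes, which preserves the fibre.
\<close>

lemma natural_iso_act:
  fixes \<iota> :: "'u \<times> 'a \<times> 'a adj \<Rightarrow> 'u"
  assumes \<iota>: "inj_on \<iota> (UNIV \<times> carrier U)"
  shows "natural_iso (Act (pi1 Q q)) (Act (pi1 Q q)) id_functor
    (comp_functor (Phi Q q) (Psi_in \<iota> Q q))
    (\<lambda>X. compose (carrier X) (restrict (class_code \<iota>) (carrier (fibre (psi_cov Q q X)))) (act_unit X))"
  unfolding natural_iso_def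
proof (intro conjI ballI)
  let ?j = "class_code \<iota>"
  let ?\<theta> = "\<lambda>X. compose (carrier X) (restrict ?j (carrier (fibre (psi_cov Q q X)))) (act_unit X)"
  let ?FG = "comp_functor (Phi Q q) (Psi_in \<iota> Q q)"
  have FG: "fobj ?FG X = fibre (fobj (relabel ?j) (psi_cov Q q X))" for X :: "('u, 'a adj) gset"
    by (simp add: comp_functor_def Psi_in_def Psi_def)
  fix X :: "('u, 'a adj) gset" assume "X \<in> Obj (Act (pi1 Q q))"
  note X = Act_objD[OF this]
  note cov = pi1_set.is_covering_psi[OF X]
  note inj = pi1_set.inj_on_class_code[OF X(1) \<iota>]
  note rcov = is_covering_relabel[OF cov inj]
  have "restrict (restrict ?j (carrier (psi_cov Q q X))) (carrier (fibre (psi_cov Q q X))) =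
      restrict ?j (carrier (fibre (psi_cov Q q X)))"
    by (auto simp: fun_eq_iff fibre_carrier)
  then have "act_iso (pi1 Q q) X (fobj ?FG X) (?\<theta> X)"
    unfolding FG
    using act_iso_compose[OF act_iso_unit[OF X] act_iso_Phi[OF cov rcov cov_iso_relabel[OF cov inj]]
        pi1_set.right_action[OF X(1)] right_action_fibre[OF rcov]] by simp
  then show "is_iso (Act (pi1 Q q)) (fobj id_functor X) (fobj ?FG X) (?\<theta> X)"
    by (simp add: id_functor_def act_iso_is_iso)
  fix Y \<phi> assume "Y \<in> Obj (Act (pi1 Q q))" "\<phi> \<in> Hom (Act (pi1 Q q)) X Y"
  then have Y: "pi1_set Q q Y" "carrier Y \<noteq> {}" and \<phi>: "\<phi> \<in> act_hom (pi1 Q q) X Y"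
    using Act_objD by (auto simp: Act_def)
  have unit: "act_unit Z x \<in> carrier (fibre (psi_cov Q q Z))"
    if "pi1_set Q q Z" "carrier Z \<noteq> {}" "x \<in> carrier Z" for Z :: "('u, 'a adj) gset" and x
    using act_iso_unit[OF that(1,2)] that(3) unfolding act_iso_def by (blast intro: act_homD(2))
  have "compose (carrier X) (?\<theta> Y) \<phi> = compose (carrier X) (fmap ?FG X Y \<phi>) (?\<theta> X)"
  proof (rule extensionalityI[OF compose_extensional compose_extensional])
    fix x assume x: "x \<in> carrier X"
    note u = unit[OF X x]
    have uP: "act_unit X x \<in> carrier (psi_cov Q q X)" "proj (psi_cov Q q X) (act_unit X x) = q"
      using u by (simp_all add: fibre_carrier)
    then have "?j (act_unit X x) \<in> carrier (fibre (fobj (relabel ?j) (psi_cov Q q X)))"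
      by (simp add: fibre_carrier relabel_simps[OF inj])
    then have "fmap ?FG X Y \<phi> (?j (act_unit X x)) =
        fmap (relabel ?j) (psi_cov Q q X) (psi_cov Q q Y) (fmap (Psi Q q) X Y \<phi>) (?j (act_unit X x))"
      using Phi_fmap by (simp add: comp_functor_def Psi_in_def) (simp add: Psi_def)
    also have "\<dots> = ?j (act_unit Y (\<phi> x))"
      using act_unit_natural[OF X Y(1) \<phi> x] u
      by (simp add: relabel_simps(5)[OF inj uP(1)] Phi_fmap)
    finally show "compose (carrier X) (?\<theta> Y) \<phi> x = compose (carrier X) (fmap ?FG X Y \<phi>) (?\<theta> X) x"
      using x u act_homD(2)[OF \<phi> x] unit[OF Y act_homD(2)[OF \<phi> x]] by (simp add: compose_eq)
  qed
  then show "Comp (Act (pi1 Q q)) (fobj id_functor X) (fobj id_functor Y) (fobj ?FG Y) (?\<theta> Y)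
        (fmap id_functor X Y \<phi>) =
      Comp (Act (pi1 Q q)) (fobj id_functor X) (fobj ?FG X) (fobj ?FG Y) (fmap ?FG X Y \<phi>) (?\<theta> X)"
    by (simp add: id_functor_def Act_def)
qed

lemma equivalence_Phi_Psi_in:
  fixes \<iota> :: "'u \<times> 'a \<times> 'a adj \<Rightarrow> 'u"
  assumes \<iota>: "inj_on \<iota> (UNIV \<times> carrier U)"
  shows "equivalence_of_categories (Cov Q) (Act (pi1 Q q)) (Phi Q q) (Psi_in \<iota> Q q)"
proof -
  have "is_functor (Act (pi1 Q q)) (Cov Q) (Psi_in \<iota> Q q)"
    unfolding Psi_in_def
    using pi1_set.inj_on_class_code[OF Act_objD(1) \<iota>]
    by (intro is_functor_relabel[OF is_functor_Psi]) (simp add: Psi_def)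
  then show ?thesis
    unfolding equivalence_of_categories_def
    using is_category_Cov is_category_Act is_functor_Phi natural_iso_cov[OF \<iota>]
      natural_iso_act[OF \<iota>] by blast
qed

end

theorem theorem6p6:
  fixes Q :: "'a quandle" and q :: 'a
  assumes "connected_quandle Q" and "q \<in> carrier Q"
  shows
    "(is_category (Cov Q :: (('u, 'a) covering, 'u \<Rightarrow> 'u) category_data) \<and>
      is_category (Act (pi1 Q q) :: (('u, 'a adj) gset, 'u \<Rightarrow> 'u) category_data) \<and>
      is_functor (Cov Q :: (('u, 'a) covering, 'u \<Rightarrow> 'u) category_data)
        (Act (pi1 Q q)) (Phi Q q) \<and>
      is_functor (Act (pi1 Q q) :: (('u, 'a adj) gset, 'u \<Rightarrow> 'u) category_data)
        (Cov Q) (Psi Q q) \<and>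
      (\<exists>\<eta> :: ('u, 'a) covering \<Rightarrow> 'u \<Rightarrow> ('u \<times> 'a \<times> 'a adj) set.
        (\<forall>P\<in>Obj (Cov Q).
           cov_iso P (fobj (comp_functor (Psi Q q) (Phi Q q)) P) (\<eta> P)) \<and>
        (\<forall>P\<in>Obj (Cov Q). \<forall>R\<in>Obj (Cov Q). \<forall>\<phi>\<in>Hom (Cov Q) P R. \<forall>x\<in>carrier P.
           \<eta> R (\<phi> x) = fmap (comp_functor (Psi Q q) (Phi Q q)) P R \<phi> (\<eta> P x))) \<and>
      (\<exists>\<theta> :: ('u, 'a adj) gset \<Rightarrow> 'u \<Rightarrow> ('u \<times> 'a \<times> 'a adj) set.
        (\<forall>X\<in>Obj (Act (pi1 Q q)).
           act_iso (pi1 Q q) X (fobj (comp_functor (Phi Q q) (Psi Q q)) X) (\<theta> X)) \<and>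
        (\<forall>X\<in>Obj (Act (pi1 Q q)). \<forall>Y\<in>Obj (Act (pi1 Q q)).
         \<forall>\<phi>\<in>Hom (Act (pi1 Q q)) X Y. \<forall>x\<in>carrier X.
           \<theta> Y (\<phi> x) = fmap (comp_functor (Phi Q q) (Psi Q q)) X Y \<phi> (\<theta> X x))))
     \<and>
     (\<forall>\<iota> :: 'u \<times> 'a \<times> 'a adj \<Rightarrow> 'u. inj_on \<iota> (UNIV \<times> carrier (univ_cov Q q)) \<longrightarrow>
        equivalence_of_categories (Cov Q) (Act (pi1 Q q)) (Phi Q q) (Psi_in \<iota> Q q))"
proof -
  interpret pointed_connected_quandle Q q
    using assms by (simp add: pointed_connected_quandle_def pointed_connected_quandle_axioms_def)
  have Psi_obj: "fobj (Psi Q q) X = psi_cov Q q X" for X :: "('u, 'a adj) gset"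
    by (simp add: Psi_def)
  have cov: "is_covering Q P" if "P \<in> Obj (Cov Q)" for P :: "('u, 'a) covering"
    using that by (simp add: Cov_def)
  have unit: "\<exists>\<eta> :: ('u, 'a) covering \<Rightarrow> 'u \<Rightarrow> ('u \<times> 'a \<times> 'a adj) set.
      (\<forall>P\<in>Obj (Cov Q). cov_iso P (fobj (comp_functor (Psi Q q) (Phi Q q)) P) (\<eta> P)) \<and>
      (\<forall>P\<in>Obj (Cov Q). \<forall>R\<in>Obj (Cov Q). \<forall>\<phi>\<in>Hom (Cov Q) P R. \<forall>x\<in>carrier P.
         \<eta> R (\<phi> x) = fmap (comp_functor (Psi Q q) (Phi Q q)) P R \<phi> (\<eta> P x))"
  proof (intro exI[of _ cov_unit] conjI ballI)
    fix P :: "('u, 'a) covering" assume P: "P \<in> Obj (Cov Q)"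
    show "cov_iso P (fobj (comp_functor (Psi Q q) (Phi Q q)) P) (cov_unit P)"
      using cov_iso_unit[OF cov[OF P]] by (simp add: comp_functor_def Psi_obj)
    fix R :: "('u, 'a) covering" and \<phi> x
    assume R: "R \<in> Obj (Cov Q)" and "\<phi> \<in> Hom (Cov Q) P R" and x: "x \<in> carrier P"
    then have "\<phi> \<in> cov_hom P R" by (simp add: Cov_def)
    from cov_unit_natural[OF cov[OF P] cov[OF R] this x]
    show "cov_unit R (\<phi> x) = fmap (comp_functor (Psi Q q) (Phi Q q)) P R \<phi> (cov_unit P x)"
      by (simp add: comp_functor_def)
  qed
  have counit: "\<exists>\<theta> :: ('u, 'a adj) gset \<Rightarrow> 'u \<Rightarrow> ('u \<times> 'a \<times> 'a adj) set.
      (\<forall>X\<in>Obj (Act (pi1 Q q)).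
         act_iso (pi1 Q q) X (fobj (comp_functor (Phi Q q) (Psi Q q)) X) (\<theta> X)) \<and>
      (\<forall>X\<in>Obj (Act (pi1 Q q)). \<forall>Y\<in>Obj (Act (pi1 Q q)).
       \<forall>\<phi>\<in>Hom (Act (pi1 Q q)) X Y. \<forall>x\<in>carrier X.
         \<theta> Y (\<phi> x) = fmap (comp_functor (Phi Q q) (Psi Q q)) X Y \<phi> (\<theta> X x))"
  proof (intro exI[of _ act_unit] conjI ballI)
    fix X :: "('u, 'a adj) gset" assume X: "X \<in> Obj (Act (pi1 Q q))"
    show "act_iso (pi1 Q q) X (fobj (comp_functor (Phi Q q) (Psi Q q)) X) (act_unit X)"
      using act_iso_unit[OF Act_objD[OF X]] by (simp add: comp_functor_def Psi_obj)
    fix Y :: "('u, 'a adj) gset" and \<phi> x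
    assume Y: "Y \<in> Obj (Act (pi1 Q q))" and "\<phi> \<in> Hom (Act (pi1 Q q)) X Y"
      and x: "x \<in> carrier X"
    then have "\<phi> \<in> act_hom (pi1 Q q) X Y" by (simp add: Act_def)
    from act_unit_natural[OF Act_objD[OF X] Act_objD(1)[OF Y] this x]
    show "act_unit Y (\<phi> x) = fmap (comp_functor (Phi Q q) (Psi Q q)) X Y \<phi> (act_unit X x)"
      by (simp add: comp_functor_def Psi_obj)
  qed
  show ?thesis
    using is_category_Cov is_category_Act is_functor_Phi is_functor_Psi unit counit
      equivalence_Phi_Psi_in by (intro conjI allI impI)
qed

end
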